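(* Let $R$ be a unital commutative associative ring with $2\in R^\times$, $S$ a quadratic étale $R$-algebra with canonical involution $\overline{\phantom{x}}$, $(P,h)$ a nondegenerate $\overline{\phantom{x}}$-hermitian space of rank three over $S$ with trivial determinant, $\alpha:\bigwedge^3(P,h)\to\langle1\rangle$ an isomorphism, and $C={\rm Col}(S,P,h,\alpha)$. Then $${\rm Aut}_S(C)={\rm Aut}(W(S,P,h,\alpha))\cap{\rm End}_S(P)\quad\text{and}\quad {\rm Aut}_R(C)={\rm Aut}(W(S,P,h,\alpha)),$$ where $f\in{\rm Aut}(W(S,P,h,\alpha))$ is identified with the map $G_f$ on $C$ given by $G_f((a,u))=(a,f(u))$ for $a\in R$, $u\in P$ (and conversely $G\in{\rm Aut}_R(C)$ with its restriction $G|_P$).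
   Context: A nondegenerate hermitian space $(P,h)$ of rank three over $S$ is a finitely generated projective $S$-module $P$ of constant rank three with a biadditive map $h:P\times P\to S$ that is $S$-linear in the first and conjugate-linear in the second variable, satisfies $h(w,w')=\overline{h(w',w)}$, and is such that $w\mapsto h(\cdot,w)$ is a conjugate-linear bijection $P\to{\rm Hom}_S(P,S)$. $\bigwedge^3(P,h)$ is $\bigwedge^3_S P$ with the hermitian form determined by $(u_1\wedge u_2\wedge u_3,v_1\wedge v_2\wedge v_3)\mapsto\det(h(u_i,v_j))$; $\langle1\rangle$ is $S$ with the form $(a,b)\mapsto a\bar b$. The space has trivial determinant if there is an isomorphism of hermitian spaces $\alpha:\bigwedge^3(P,h)\to\langle1\rangle$. Given $\alpha$, the cross product $\times_\alpha:P\times P\to P$ is defined by $h(u,v\times_\alpha w)=\alpha(u\wedge v\wedge w)$ for all $u,v,w\in P$. The associated $R$-algebras are: - $W(S,P,h,\alpha)=(P,\times_\alpha)$ (vector algebra); - ${\rm Col}(S,P,h,\alpha)=R\oplus P$ with $(a,u)(b,v)=(ab-\frac12(h(u,v)+\overline{h(u,v)}),\,va+ub+u\times_\alpha v)$ for $a,b\in R$, $u,v\in P$ (colour algebra). ${\rm Aut}$ and ${\rm Aut}_R$ denote the group of $R$-algebra automorphisms; ${\rm Aut}_S(C)$ denotes the group of those $G\in{\rm Aut}_R(C)$ whose restriction to $P$ is an $S$-linear map $P\to P$. *)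

theory Defs
  imports "HOL-Analysis.Analysis" "HOL-Library.Poly_Mapping" "HOL-Library.FuncSet"
begin

text \<open>
  The rings \<open>R\<close> and \<open>S\<close> are types of class \<open>comm_ring_1\<close>; a module is an additive type together
  with a scalar multiplication \<open>sc\<close>, as in the locale \<open>module\<close> of \<open>HOL.Modules\<close>. The
  \<open>R\<close>-algebra structure on \<open>S\<close> is given by the structure map \<open>\<iota> : R \<rightarrow> S\<close>.
\<close>

section \<open>Localization and rank\<close>

definition prime_ideal :: "'a::comm_ring_1 set \<Rightarrow> bool" where
  "prime_ideal p \<longleftrightarrow> module.subspace (*) p \<and> 1 \<notin> p \<and> (\<forall>a b. a * b \<in> p \<longrightarrow> a \<in> p \<or> b \<in> p)"

definition loc_rel ::
    "('a::comm_ring_1 \<Rightarrow> 'm::ab_group_add \<Rightarrow> 'm) \<Rightarrow> 'a set \<Rightarrow> (('m \<times> 'a) \<times> ('m \<times> 'a)) set" where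
  "loc_rel sc p = {((m, s), (m', s')). s \<notin> p \<and> s' \<notin> p \<and> (\<exists>t. t \<notin> p \<and> sc t (sc s' m - sc s m') = 0)}"

text \<open>The fraction \<open>m/s\<close>, and the localization \<open>M\<^sub>p\<close>. The local ring \<open>A\<^sub>p\<close> is the case of the
  regular module, \<open>sc = (*)\<close>.\<close>

definition loc_frac ::
    "('a::comm_ring_1 \<Rightarrow> 'm::ab_group_add \<Rightarrow> 'm) \<Rightarrow> 'a set \<Rightarrow> 'm \<Rightarrow> 'a \<Rightarrow> ('m \<times> 'a) set" where
  "loc_frac sc p m s = loc_rel sc p `` {(m, s)}"

definition localization ::
    "('a::comm_ring_1 \<Rightarrow> 'm::ab_group_add \<Rightarrow> 'm) \<Rightarrow> 'a set \<Rightarrow> ('m \<times> 'a) set set" where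
  "localization sc p = (UNIV \<times> (- p)) // loc_rel sc p"

text \<open>The unions below are over representatives of the arguments; all of them yield the same class.\<close>

definition loc_add ::
    "('a::comm_ring_1 \<Rightarrow> 'm::ab_group_add \<Rightarrow> 'm) \<Rightarrow> 'a set
      \<Rightarrow> ('m \<times> 'a) set \<Rightarrow> ('m \<times> 'a) set \<Rightarrow> ('m \<times> 'a) set" where
  "loc_add sc p X Y =
     (\<Union>(m, s)\<in>X. \<Union>(m', s')\<in>Y. loc_frac sc p (sc s' m + sc s m') (s * s'))"

definition loc_scale ::
    "('a::comm_ring_1 \<Rightarrow> 'm::ab_group_add \<Rightarrow> 'm) \<Rightarrow> 'a set
      \<Rightarrow> ('a \<times> 'a) set \<Rightarrow> ('m \<times> 'a) set \<Rightarrow> ('m \<times> 'a) set" where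
  "loc_scale sc p A X =
     (\<Union>(a, s)\<in>A. \<Union>(m, s')\<in>X. loc_frac sc p (sc a m) (s * s'))"

text \<open>\<open>M\<^sub>p\<close> is free of rank \<open>n\<close>: it is isomorphic to \<open>(A\<^sub>p)\<^sup>n\<close> as an \<open>A\<^sub>p\<close>-module.\<close>

definition loc_free_of_rank ::
    "('a::comm_ring_1 \<Rightarrow> 'm::ab_group_add \<Rightarrow> 'm) \<Rightarrow> 'a set \<Rightarrow> nat \<Rightarrow> bool" where
  "loc_free_of_rank sc p n \<longleftrightarrow>
     (let F = {..<n} \<rightarrow>\<^sub>E localization (*) p in
      \<exists>\<Phi>. bij_betw \<Phi> F (localization sc p) \<and>
        (\<forall>c\<in>F. \<forall>d\<in>F. \<Phi> (\<lambda>i\<in>{..<n}. loc_add (*) p (c i) (d i)) = loc_add sc p (\<Phi> c) (\<Phi> d)) \<and>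
        (\<forall>a\<in>localization (*) p. \<forall>c\<in>F.
           \<Phi> (\<lambda>i\<in>{..<n}. loc_scale (*) p a (c i)) = loc_scale sc p a (\<Phi> c)))"

definition constant_rank :: "('a::comm_ring_1 \<Rightarrow> 'm::ab_group_add \<Rightarrow> 'm) \<Rightarrow> nat \<Rightarrow> bool" where
  "constant_rank sc n \<longleftrightarrow> (\<forall>p. prime_ideal p \<longrightarrow> loc_free_of_rank sc p n)"

section \<open>Finitely generated projective modules\<close>

definition linear_forms :: "('a::comm_ring_1 \<Rightarrow> 'm::ab_group_add \<Rightarrow> 'm) \<Rightarrow> ('m \<Rightarrow> 'a) set" where
  "linear_forms sc = {f. module_hom sc (*) f}"

text \<open>\<open>M\<close> is a direct summand of the free module \<open>A\<^sup>n\<close>: the map \<open>x \<mapsto> (\<phi>\<^sub>i(x))\<^sub>i\<close> from \<open>M\<close> to \<open>A\<^sup>n\<close>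
  followed by the map \<open>A\<^sup>n \<rightarrow> M\<close> that sends the standard basis to the \<open>b\<^sub>i\<close> is the identity.\<close>

definition dual_basis ::
    "('a::comm_ring_1 \<Rightarrow> 'm::ab_group_add \<Rightarrow> 'm) \<Rightarrow> nat \<Rightarrow> (nat \<Rightarrow> 'm) \<Rightarrow> (nat \<Rightarrow> 'm \<Rightarrow> 'a) \<Rightarrow> bool" where
  "dual_basis sc n b \<phi> \<longleftrightarrow> (\<forall>i<n. \<phi> i \<in> linear_forms sc) \<and> (\<forall>x. (\<Sum>i<n. sc (\<phi> i x) (b i)) = x)"

definition fg_projective :: "('a::comm_ring_1 \<Rightarrow> 'm::ab_group_add \<Rightarrow> 'm) \<Rightarrow> bool" where
  "fg_projective sc \<longleftrightarrow> module sc \<and> (\<exists>n b \<phi>. dual_basis sc n b \<phi>)"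

text \<open>The trace of an endomorphism of a finitely generated projective module; the value does not
  depend on the dual basis.\<close>

definition module_trace ::
    "('a::comm_ring_1 \<Rightarrow> 'm::ab_group_add \<Rightarrow> 'm) \<Rightarrow> ('m \<Rightarrow> 'm) \<Rightarrow> 'a" where
  "module_trace sc f = (THE t. \<exists>n b \<phi>. dual_basis sc n b \<phi> \<and> t = (\<Sum>i<n. \<phi> i (f (b i))))"

section \<open>Quadratic etale algebras and their canonical involution\<close>

definition ring_morphism :: "('a::comm_ring_1 \<Rightarrow> 'b::comm_ring_1) \<Rightarrow> bool" where
  "ring_morphism f \<longleftrightarrow>
     f 1 = 1 \<and> (\<forall>x y. f (x + y) = f x + f y) \<and> (\<forall>x y. f (x * y) = f x * f y)"

definition alg_scale :: "('r::comm_ring_1 \<Rightarrow> 's::comm_ring_1) \<Rightarrow> 'r \<Rightarrow> 's \<Rightarrow> 's" where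
  "alg_scale \<iota> r x = \<iota> r * x"

definition alg_trace :: "('r::comm_ring_1 \<Rightarrow> 's::comm_ring_1) \<Rightarrow> 's \<Rightarrow> 'r" where
  "alg_trace \<iota> x = module_trace (alg_scale \<iota>) (\<lambda>y. x * y)"

text \<open>An algebra that is finitely generated projective as a module is etale iff its trace form
  \<open>(x, y) \<mapsto> tr(xy)\<close> is nondegenerate, that is, induces a bijection \<open>S \<rightarrow> Hom\<^sub>R(S, R)\<close>.\<close>

definition quadratic_etale :: "('r::comm_ring_1 \<Rightarrow> 's::comm_ring_1) \<Rightarrow> bool" where
  "quadratic_etale \<iota> \<longleftrightarrow>
     ring_morphism \<iota> \<and> fg_projective (alg_scale \<iota>) \<and> constant_rank (alg_scale \<iota>) 2 \<and>
     bij_betw (\<lambda>x y. alg_trace \<iota> (x * y)) UNIV (linear_forms (alg_scale \<iota>))"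

text \<open>The canonical involution of a quadratic etale algebra is the \<open>R\<close>-algebra automorphism
  \<open>x \<mapsto> tr(x)1 - x\<close>.\<close>

definition canonical_involution ::
    "('r::comm_ring_1 \<Rightarrow> 's::comm_ring_1) \<Rightarrow> ('s \<Rightarrow> 's) \<Rightarrow> bool" where
  "canonical_involution \<iota> cj \<longleftrightarrow>
     ring_morphism cj \<and> (\<forall>r. cj (\<iota> r) = \<iota> r) \<and> (\<forall>x. cj (cj x) = x) \<and>
     (\<forall>x. cj x = \<iota> (alg_trace \<iota> x) - x)"

section \<open>Hermitian spaces\<close>

definition nondegenerate_hermitian ::
    "('s::comm_ring_1 \<Rightarrow> 's) \<Rightarrow> ('s \<Rightarrow> 'p::ab_group_add \<Rightarrow> 'p) \<Rightarrow> ('p \<Rightarrow> 'p \<Rightarrow> 's) \<Rightarrow> bool" where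
  "nondegenerate_hermitian cj sc h \<longleftrightarrow>
     (\<forall>w. module_hom sc (*) (\<lambda>u. h u w)) \<and>
     (\<forall>u w w'. h u (w + w') = h u w + h u w') \<and>
     (\<forall>c u w. h u (sc c w) = cj c * h u w) \<and>
     (\<forall>w w'. h w w' = cj (h w' w)) \<and>
     bij_betw (\<lambda>w u. h u w) UNIV (linear_forms sc)"

definition hermitian_space_rank3 ::
    "('s::comm_ring_1 \<Rightarrow> 's) \<Rightarrow> ('s \<Rightarrow> 'p::ab_group_add \<Rightarrow> 'p) \<Rightarrow> ('p \<Rightarrow> 'p \<Rightarrow> 's) \<Rightarrow> bool" where
  "hermitian_space_rank3 cj sc h \<longleftrightarrow>
     fg_projective sc \<and> constant_rank sc 3 \<and> nondegenerate_hermitian cj sc h"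

section \<open>The third exterior power\<close>

text \<open>The exterior power is the quotient of the free module on all triples by the submodule spanned
  by the multilinearity and alternation relations; its elements are cosets. The module structure is
  the one for which the quotient map \<open>ext3_class sc\<close> is linear.\<close>

definition free_scale :: "'s::comm_ring_1 \<Rightarrow> ('k \<Rightarrow>\<^sub>0 's) \<Rightarrow> ('k \<Rightarrow>\<^sub>0 's)" where
  "free_scale c = Poly_Mapping.map ((*) c)"

definition vec_upd :: "'p ^ 'n \<Rightarrow> 'n \<Rightarrow> 'p \<Rightarrow> 'p ^ 'n" where
  "vec_upd u i x = (\<chi> j. if j = i then x else u $ j)"

definition ext3_relations ::
    "('s::comm_ring_1 \<Rightarrow> 'p::ab_group_add \<Rightarrow> 'p) \<Rightarrow> (('p ^ 3) \<Rightarrow>\<^sub>0 's) set" where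
  "ext3_relations sc = module.span free_scale
     ({Poly_Mapping.single (vec_upd u i (x + y)) 1
         - Poly_Mapping.single (vec_upd u i x) 1 - Poly_Mapping.single (vec_upd u i y) 1
        | u i x y. True} \<union>
      {Poly_Mapping.single (vec_upd u i (sc c x)) 1
         - free_scale c (Poly_Mapping.single (vec_upd u i x) 1) | u i c x. True} \<union>
      {Poly_Mapping.single u 1 | u. \<exists>i j. i \<noteq> j \<and> u $ i = u $ j})"

definition ext3_class ::
    "('s::comm_ring_1 \<Rightarrow> 'p::ab_group_add \<Rightarrow> 'p) \<Rightarrow> (('p ^ 3) \<Rightarrow>\<^sub>0 's) \<Rightarrow> (('p ^ 3) \<Rightarrow>\<^sub>0 's) set" where
  "ext3_class sc x = {y. y - x \<in> ext3_relations sc}"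

definition ext3 ::
    "('s::comm_ring_1 \<Rightarrow> 'p::ab_group_add \<Rightarrow> 'p) \<Rightarrow> (('p ^ 3) \<Rightarrow>\<^sub>0 's) set set" where
  "ext3 sc = range (ext3_class sc)"

definition wedge3 ::
    "('s::comm_ring_1 \<Rightarrow> 'p::ab_group_add \<Rightarrow> 'p) \<Rightarrow> 'p \<Rightarrow> 'p \<Rightarrow> 'p \<Rightarrow> (('p ^ 3) \<Rightarrow>\<^sub>0 's) set" where
  "wedge3 sc u v w = ext3_class sc (Poly_Mapping.single (vector [u, v, w]) 1)"

text \<open>The sesquilinear extension to the free module of
  \<open>(u\<^sub>1 \<and> u\<^sub>2 \<and> u\<^sub>3, v\<^sub>1 \<and> v\<^sub>2 \<and> v\<^sub>3) \<mapsto> det(h(u\<^sub>i, v\<^sub>j))\<close>. It depends on the classes of its arguments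
  only, and induces the form on the exterior power.\<close>

definition free_det_form ::
    "('s::comm_ring_1 \<Rightarrow> 's) \<Rightarrow> ('p \<Rightarrow> 'p \<Rightarrow> 's) \<Rightarrow> (('p ^ 3) \<Rightarrow>\<^sub>0 's) \<Rightarrow> (('p ^ 3) \<Rightarrow>\<^sub>0 's) \<Rightarrow> 's" where
  "free_det_form cj h x y =
     (\<Sum>u\<in>Poly_Mapping.keys x. \<Sum>v\<in>Poly_Mapping.keys y.
        Poly_Mapping.lookup x u * cj (Poly_Mapping.lookup y v) *
        det (\<chi> i j. h (u $ i) (v $ j)))"

definition ext3_form ::
    "('s::comm_ring_1 \<Rightarrow> 's) \<Rightarrow> ('p \<Rightarrow> 'p \<Rightarrow> 's) \<Rightarrow>
      (('p ^ 3) \<Rightarrow>\<^sub>0 's) set \<Rightarrow> (('p ^ 3) \<Rightarrow>\<^sub>0 's) set \<Rightarrow> 's" where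
  "ext3_form cj h X Y = (THE z. \<exists>x\<in>X. \<exists>y\<in>Y. z = free_det_form cj h x y)"

text \<open>An isomorphism of hermitian spaces from the third exterior power to \<open>S\<close> with the form
  \<open>(a, b) \<mapsto> a * cj b\<close>.\<close>

definition det_trivialization ::
    "('s::comm_ring_1 \<Rightarrow> 's) \<Rightarrow> ('s \<Rightarrow> 'p::ab_group_add \<Rightarrow> 'p) \<Rightarrow> ('p \<Rightarrow> 'p \<Rightarrow> 's) \<Rightarrow>
      ((('p ^ 3) \<Rightarrow>\<^sub>0 's) set \<Rightarrow> 's) \<Rightarrow> bool" where
  "det_trivialization cj sc h \<alpha> \<longleftrightarrow>
     bij_betw \<alpha> (ext3 sc) UNIV \<and>
     module_hom free_scale (*) (\<lambda>x. \<alpha> (ext3_class sc x)) \<and>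
     (\<forall>X\<in>ext3 sc. \<forall>Y\<in>ext3 sc. ext3_form cj h X Y = \<alpha> X * cj (\<alpha> Y))"

section \<open>The vector algebra and the colour algebra\<close>

definition cross_product ::
    "('s::comm_ring_1 \<Rightarrow> 'p::ab_group_add \<Rightarrow> 'p) \<Rightarrow> ('p \<Rightarrow> 'p \<Rightarrow> 's) \<Rightarrow>
      ((('p ^ 3) \<Rightarrow>\<^sub>0 's) set \<Rightarrow> 's) \<Rightarrow> 'p \<Rightarrow> 'p \<Rightarrow> 'p" where
  "cross_product sc h \<alpha> v w = (THE x. \<forall>u. h u x = \<alpha> (wedge3 sc u v w))"

text \<open>The underlying \<open>R\<close>-module of the vector algebra is \<open>P\<close> and that of the colour algebra is
  \<open>R \<oplus> P\<close>.\<close>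

definition vec_scale ::
    "('r::comm_ring_1 \<Rightarrow> 's::comm_ring_1) \<Rightarrow> ('s \<Rightarrow> 'p::ab_group_add \<Rightarrow> 'p) \<Rightarrow> 'r \<Rightarrow> 'p \<Rightarrow> 'p" where
  "vec_scale \<iota> sc r u = sc (\<iota> r) u"

definition col_scale ::
    "('r::comm_ring_1 \<Rightarrow> 's::comm_ring_1) \<Rightarrow> ('s \<Rightarrow> 'p::ab_group_add \<Rightarrow> 'p) \<Rightarrow>
      'r \<Rightarrow> 'r \<times> 'p \<Rightarrow> 'r \<times> 'p" where
  "col_scale \<iota> sc r x = (r * fst x, vec_scale \<iota> sc r (snd x))"

text \<open>\<open>h u v + cj (h u v)\<close> lies in the image of the injective map \<open>\<iota>\<close> and is read as an element of
  \<open>R\<close>; the first factor of the subtracted term is \<open>1/2\<close>.\<close>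

definition col_mult ::
    "('r::comm_ring_1 \<Rightarrow> 's::comm_ring_1) \<Rightarrow> ('s \<Rightarrow> 's) \<Rightarrow> ('s \<Rightarrow> 'p::ab_group_add \<Rightarrow> 'p) \<Rightarrow>
      ('p \<Rightarrow> 'p \<Rightarrow> 's) \<Rightarrow> ((('p ^ 3) \<Rightarrow>\<^sub>0 's) set \<Rightarrow> 's) \<Rightarrow>
      'r \<times> 'p \<Rightarrow> 'r \<times> 'p \<Rightarrow> 'r \<times> 'p" where
  "col_mult \<iota> cj sc h \<alpha> = (\<lambda>(a, u) (b, v).
     (a * b - (THE c. 2 * c = 1) * (THE t. \<iota> t = h u v + cj (h u v)),
      vec_scale \<iota> sc a v + vec_scale \<iota> sc b u + cross_product sc h \<alpha> u v))"

section \<open>Automorphism groups\<close>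

text \<open>Automorphisms of a (nonassociative) algebra with scalar multiplication \<open>sc\<close> and product
  \<open>mul\<close>; the group operation is composition.\<close>

definition alg_aut ::
    "('r::comm_ring_1 \<Rightarrow> 'c::ab_group_add \<Rightarrow> 'c) \<Rightarrow> ('c \<Rightarrow> 'c \<Rightarrow> 'c) \<Rightarrow> ('c \<Rightarrow> 'c) set" where
  "alg_aut sc mul = {f. module_hom sc sc f \<and> bij f \<and> (\<forall>x y. f (mul x y) = mul (f x) (f y))}"

definition Aut_W ::
    "('r::comm_ring_1 \<Rightarrow> 's::comm_ring_1) \<Rightarrow> ('s \<Rightarrow> 'p::ab_group_add \<Rightarrow> 'p) \<Rightarrow>
      ('p \<Rightarrow> 'p \<Rightarrow> 's) \<Rightarrow> ((('p ^ 3) \<Rightarrow>\<^sub>0 's) set \<Rightarrow> 's) \<Rightarrow> ('p \<Rightarrow> 'p) set" where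
  "Aut_W \<iota> sc h \<alpha> = alg_aut (vec_scale \<iota> sc) (cross_product sc h \<alpha>)"

definition End_S :: "('s::comm_ring_1 \<Rightarrow> 'p::ab_group_add \<Rightarrow> 'p) \<Rightarrow> ('p \<Rightarrow> 'p) set" where
  "End_S sc = {f. module_hom sc sc f}"

definition Aut_R_Col ::
    "('r::comm_ring_1 \<Rightarrow> 's::comm_ring_1) \<Rightarrow> ('s \<Rightarrow> 's) \<Rightarrow> ('s \<Rightarrow> 'p::ab_group_add \<Rightarrow> 'p) \<Rightarrow>
      ('p \<Rightarrow> 'p \<Rightarrow> 's) \<Rightarrow> ((('p ^ 3) \<Rightarrow>\<^sub>0 's) set \<Rightarrow> 's) \<Rightarrow> ('r \<times> 'p \<Rightarrow> 'r \<times> 'p) set" where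
  "Aut_R_Col \<iota> cj sc h \<alpha> = alg_aut (col_scale \<iota> sc) (col_mult \<iota> cj sc h \<alpha>)"

definition preserves_P :: "('r::zero \<times> 'p \<Rightarrow> 'r \<times> 'p) \<Rightarrow> bool" where
  "preserves_P G \<longleftrightarrow> (\<forall>u. fst (G (0, u)) = 0)"

text \<open>The restriction \<open>G|\<^sub>P\<close>; meaningful if \<open>G\<close> maps \<open>P\<close> to itself.\<close>

definition restrict_P :: "('r::zero \<times> 'p \<Rightarrow> 'r \<times> 'p) \<Rightarrow> 'p \<Rightarrow> 'p" where
  "restrict_P G u = snd (G (0, u))"

definition Aut_S_Col ::
    "('r::comm_ring_1 \<Rightarrow> 's::comm_ring_1) \<Rightarrow> ('s \<Rightarrow> 's) \<Rightarrow> ('s \<Rightarrow> 'p::ab_group_add \<Rightarrow> 'p) \<Rightarrow>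
      ('p \<Rightarrow> 'p \<Rightarrow> 's) \<Rightarrow> ((('p ^ 3) \<Rightarrow>\<^sub>0 's) set \<Rightarrow> 's) \<Rightarrow> ('r \<times> 'p \<Rightarrow> 'r \<times> 'p) set" where
  "Aut_S_Col \<iota> cj sc h \<alpha> =
     {G \<in> Aut_R_Col \<iota> cj sc h \<alpha>. preserves_P G \<and> restrict_P G \<in> End_S sc}"

definition extend_Col :: "('p \<Rightarrow> 'p) \<Rightarrow> 'r \<times> 'p \<Rightarrow> 'r \<times> 'p" where
  "extend_Col f = (\<lambda>(a, u). (a, f u))"

end

theory Submission
  imports Defs
begin

text \<open>
  The colour algebra has unit element \<open>(1, 0)\<close>, and its multiplication on \<open>P\<close> has the cross product as
  component in \<open>P\<close> and \<open>-1/2\<close> times the trace of \<open>h\<close> as component in \<open>R\<close>. So the theorem comes down to two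
  facts: every automorphism of the vector algebra preserves the trace of \<open>h\<close>, and every automorphism of
  the colour algebra maps \<open>P\<close> to itself. Both follow from the triple product expansion
  \<open>(u \<times> v) \<times> w = h(u, w) v - h(v, w) u\<close> (\<open>cross_cross\<close>).

  First, the operator \<open>x \<mapsto> (x \<times> u) \<times> v\<close>, which is defined by the multiplication alone, has trace
  \<open>h(u, v) - 3 h(u, v) = -2 h(u, v)\<close> over \<open>S\<close>. Hence its trace over \<open>R\<close> is \<open>-2\<close> times the trace of \<open>h(u, v)\<close>,
  and traces over \<open>R\<close> are invariant under conjugation with an automorphism
  (\<open>vector_automorphism_preserves_trace\<close>). Second, the expansion shows, by a sum over a dual basis, that
  cross products generate \<open>P\<close> additively (\<open>additive_eq_0_if_cross\<close>). Up to the factor two they are the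
  commutators of elements of \<open>P\<close>, so \<open>P\<close> is the subgroup generated by the commutators of the colour
  algebra, which every automorphism preserves (\<open>restrict_automorphism\<close>).

  When \<open>P\<close> is free, the triple product expansion is a computation in a basis. The proof below avoids
  bases and works with the volume form \<open>vol(u, v, w) = \<alpha>(u \<and> v \<and> w)\<close>. Since \<open>\<alpha>\<close> is an isomorphism, every
  alternating trilinear form is a multiple of \<open>vol\<close>. Applied to the Leibniz action of the endomorphisms
  \<open>x \<mapsto> \<phi>(x) u\<close> this yields the contraction identity
  \<open>\<phi>(u) vol(a, b, c) = \<phi>(a) vol(u, b, c) + \<phi>(b) vol(a, u, c) + \<phi>(c) vol(a, b, u)\<close> (\<open>contraction\<close>),
  in which the rank three is encoded: it gives the trace of the identity of \<open>P\<close> (\<open>rank_eq_3\<close>), and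
  together with the isometry property of \<open>\<alpha>\<close> it gives the expansion.

  The trace of \<open>h(u, v)\<close> is an element of \<open>R\<close>, determined by its image in \<open>S\<close> because the structure map is
  injective; this is a consequence of the constant rank two of \<open>S\<close> (\<open>inj_if_constant_rank\<close>).
\<close>

section \<open>Alternating trilinear forms\<close>

text \<open>
  Linearity in the first variable and invariance under cyclic permutation carry linearity over to the
  other two variables, so that these three clauses suffice.
\<close>
definition alternating_form :: "('s::comm_ring_1 \<Rightarrow> 'p::ab_group_add \<Rightarrow> 'p) \<Rightarrow> ('p \<Rightarrow> 'p \<Rightarrow> 'p \<Rightarrow> 's) \<Rightarrow> bool" where
  "alternating_form sc F \<longleftrightarrow>
     (\<forall>v w. module_hom sc (*) (\<lambda>u. F u v w)) \<and>
     (\<forall>u v w. F v w u = F u v w) \<and> (\<forall>u w. F u u w = 0)"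

lemma module_ring: "module ((*) :: 'a::comm_ring_1 \<Rightarrow> 'a \<Rightarrow> 'a)"
  by unfold_locales (auto simp: algebra_simps)

lemma linear_formI:
  assumes "module sc" "\<And>x y. f (x + y) = f x + f y" "\<And>c x. f (sc c x) = c * f x"
  shows "module_hom sc ((*) :: 'a::comm_ring_1 \<Rightarrow> 'a \<Rightarrow> 'a) f"
  using assms module_ring by (simp add: module_hom_iff)

lemma alternating_formD:
  assumes "alternating_form sc F"
  shows "F (u + u') v w = F u v w + F u' v w" "F u (v + v') w = F u v w + F u v' w"
    "F u v (w + w') = F u v w + F u v w'"
    "F (sc c u) v w = c * F u v w" "F u (sc c v) w = c * F u v w" "F u v (sc c w) = c * F u v w"
    "F u u w = 0" "F w u u = 0" "F u w u = 0"
proof -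
  have lin: "F (u + u') v w = F u v w + F u' v w" "F (sc c u) v w = c * F u v w" for u u' v w c
    using assms module_hom.add module_hom.scale unfolding alternating_form_def by blast+
  have cyc: "F v w u = F u v w" for u v w
    using assms unfolding alternating_form_def by blast
  have alt: "F u u w = 0" for u w using assms unfolding alternating_form_def by blast
  show "F (u + u') v w = F u v w + F u' v w" "F u (v + v') w = F u v w + F u v' w"
    "F u v (w + w') = F u v w + F u v w'"
    "F (sc c u) v w = c * F u v w" "F u (sc c v) w = c * F u v w" "F u v (sc c w) = c * F u v w"
    "F u u w = 0" "F w u u = 0" "F u w u = 0"
    using lin cyc alt by metis+
qed

lemma antisymmetric_of_alternating:
  fixes B :: "'p::ab_group_add \<Rightarrow> 'p \<Rightarrow> 's::ab_group_add"
  assumes "\<And>u v w. B (u + v) w = B u w + B v w" "\<And>u v w. B u (v + w) = B u v + B u w"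
    and "\<And>u. B u u = 0"
  shows "B v u = - B u v"
proof -
  have "0 = B (u + v) (u + v)" using assms(3) by simp
  also have "\<dots> = B u v + B v u" by (simp only: assms(1,2)) (simp add: assms(3))
  finally show ?thesis by (metis add.commute eq_neg_iff_add_eq_0)
qed

lemma alternating_form_swap:
  assumes "alternating_form sc F"
  shows "F v u w = - F u v w" "F u w v = - F u v w"
proof -
  show 1: "F v u w = - F u v w" for u v w
    by (rule antisymmetric_of_alternating[of "\<lambda>u v. F u v w"])
       (simp_all add: alternating_formD[OF assms])
  show "F u w v = - F u v w"
    using 1 assms unfolding alternating_form_def by metis
qed

lemma alternating_formI:
  assumes "module sc"
    and add: "\<And>u u' v w. F (u + u') v w = F u v w + F u' v w"
      "\<And>u v v' w. F u (v + v') w = F u v w + F u v' w"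
      "\<And>u v w w'. F u v (w + w') = F u v w + F u v w'"
    and "\<And>c u v w. F (sc c u) v w = c * F u v w"
    and alt: "\<And>u w. F u u w = 0" "\<And>u w. F w u u = 0"
  shows "alternating_form sc F"
proof -
  have "F v u w = - F u v w" for u v w
    by (rule antisymmetric_of_alternating[of "\<lambda>u v. F u v w"]) (simp_all add: add alt)
  moreover have "F u w v = - F u v w" for u v w
    by (rule antisymmetric_of_alternating[of "\<lambda>v w. F u v w"]) (simp_all add: add alt)
  ultimately have "F v w u = F u v w" for u v w by (metis minus_minus)
  then show ?thesis unfolding alternating_form_def using assms by (blast intro: linear_formI)
qed

text \<open>
  The linear extension to the free module of a function on its basis.
\<close>
definition free_lift :: "('k \<Rightarrow> 's::comm_ring_1) \<Rightarrow> ('k \<Rightarrow>\<^sub>0 's) \<Rightarrow> 's" where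
  "free_lift F x = (\<Sum>u\<in>Poly_Mapping.keys x. Poly_Mapping.lookup x u * F u)"

lemma free_lift_superset:
  assumes "finite K" "Poly_Mapping.keys x \<subseteq> K"
  shows "free_lift F x = (\<Sum>u\<in>K. Poly_Mapping.lookup x u * F u)"
  unfolding free_lift_def
  by (rule sum.mono_neutral_left) (use assms in \<open>auto simp: in_keys_iff\<close>)

lemma lookup_free_scale: "Poly_Mapping.lookup (free_scale c x) u = c * Poly_Mapping.lookup x u"
  unfolding free_scale_def by (simp add: Poly_Mapping.map.rep_eq when_def)

lemma module_free_scale: "module (free_scale :: 's::comm_ring_1 \<Rightarrow> ('k \<Rightarrow>\<^sub>0 's) \<Rightarrow> _)"
  by unfold_locales (auto intro!: poly_mapping_eqI simp: lookup_free_scale lookup_add algebra_simps)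

lemma free_lift_linear:
  fixes F :: "'k \<Rightarrow> 's::comm_ring_1"
  shows "module_hom free_scale (*) (free_lift F)"
proof (rule linear_formI[OF module_free_scale])
  fix x y :: "'k \<Rightarrow>\<^sub>0 's" and c
  let ?K = "Poly_Mapping.keys x \<union> Poly_Mapping.keys y"
  have "Poly_Mapping.keys (x + y) \<subseteq> ?K" by (rule keys_add)
  then show "free_lift F (x + y) = free_lift F x + free_lift F y"
    by (subst (1 2 3) free_lift_superset[of ?K])
       (auto simp: lookup_add algebra_simps sum.distrib)
  have "Poly_Mapping.keys (free_scale c x) \<subseteq> Poly_Mapping.keys x"
    by (auto simp: in_keys_iff lookup_free_scale)
  then show "free_lift F (free_scale c x) = c * free_lift F x"
    by (subst (1 2) free_lift_superset[of "Poly_Mapping.keys x"])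
       (auto simp: lookup_free_scale algebra_simps sum_distrib_left)
qed

lemma free_lift_single [simp]: "free_lift F (Poly_Mapping.single u 1) = F u"
  by (subst free_lift_superset[of "{u}"]) (auto)

lemma free_lift_unique:
  fixes A :: "('k \<Rightarrow>\<^sub>0 's::comm_ring_1) \<Rightarrow> 's"
  assumes "module_hom free_scale (*) A"
  shows "A x = free_lift (\<lambda>u. A (Poly_Mapping.single u 1)) x"
proof -
  interpret A: module_hom free_scale "(*)" A by fact
  have "x = (\<Sum>u\<in>Poly_Mapping.keys x. free_scale (Poly_Mapping.lookup x u) (Poly_Mapping.single u 1))"
    by (rule poly_mapping_eqI)
       (auto simp: lookup_sum lookup_free_scale lookup_single when_def in_keys_iff if_distrib
             cong: if_cong)
  then have "A x = A (\<Sum>u\<in>Poly_Mapping.keys x. free_scale (Poly_Mapping.lookup x u) (Poly_Mapping.single u 1))"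
    by simp
  then show ?thesis by (simp add: A.sum A.scale free_lift_def)
qed

abbreviation of_triple :: "('p \<Rightarrow> 'p \<Rightarrow> 'p \<Rightarrow> 's) \<Rightarrow> 'p ^ 3 \<Rightarrow> 's" where
  "of_triple F u \<equiv> F (u $ 1) (u $ 2) (u $ 3)"

text \<open>
  One half of the universal property of the exterior power: the linear extension of an alternating
  form kills the generators of the relations, hence their span.
\<close>
lemma free_lift_relations:
  assumes F: "alternating_form sc F" and "x \<in> ext3_relations sc"
  shows "free_lift (of_triple F) x = 0"
proof -
  interpret L: module_hom free_scale "(*)" "free_lift (of_triple F)" by (rule free_lift_linear)
  note D = alternating_formD[OF F]
  have add: "of_triple F (vec_upd u i (x + y)) = of_triple F (vec_upd u i x) + of_triple F (vec_upd u i y)"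
    for u :: "'b ^ 3" and i x y
    using exhaust_3[of i] by (auto simp: vec_upd_def D)
  have scale: "of_triple F (vec_upd u i (sc c x)) = c * of_triple F (vec_upd u i x)"
    for u :: "'b ^ 3" and i x c
    using exhaust_3[of i] by (auto simp: vec_upd_def D)
  have alt: "of_triple F u = 0" if "i \<noteq> j" "u $ i = u $ j" for u :: "'b ^ 3" and i j
    using that exhaust_3[of i] exhaust_3[of j] by (auto simp: D)
  have "ext3_relations sc \<subseteq> {x. free_lift (of_triple F) x = 0}"
    unfolding ext3_relations_def
    by (rule L.m1.span_minimal[OF _ L.subspace_kernel])
       (auto simp: L.diff L.scale add scale dest: alt)
  with assms(2) show ?thesis by auto
qed


section \<open>Volume forms and the contraction identity\<close>

lemma two_cancel:
  fixes x :: "'a::comm_ring_1"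
  assumes "(2 :: 'a) dvd 1" "2 * x = 0"
  shows "x = 0"
proof -
  obtain c :: 'a where c: "1 = 2 * c" using assms(1) by (rule dvdE)
  have "c * (2 * x) = 0" using assms(2) by simp
  moreover have "c * (2 * x) = (2 * c) * x" by (simp only: mult_ac)
  ultimately show ?thesis by (simp flip: c)
qed

text \<open>
  A volume form is a trilinear form through which all alternating trilinear forms factor, with values
  that generate the unit ideal. It amounts to an isomorphism of the third exterior power with the
  ring. Over a field such a form exists in dimension three only; in general the rank shows up as the
  trace of the identity (\<open>rank_eq_3\<close>).
\<close>
locale volume_form = module sc
  for sc :: "'s::comm_ring_1 \<Rightarrow> 'p::ab_group_add \<Rightarrow> 'p" +
  fixes vol :: "'p \<Rightarrow> 'p \<Rightarrow> 'p \<Rightarrow> 's"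
  assumes two_unit: "(2 :: 's) dvd 1"
    and alternating: "alternating_form sc vol"
    and universal: "alternating_form sc F \<Longrightarrow> \<exists>k. \<forall>u v w. F u v w = k * vol u v w"
    and faithful: "(\<And>u v w. x * vol u v w = 0) \<Longrightarrow> x = 0"
begin

lemmas vol_simps = alternating_formD[OF alternating]
lemmas vol_swap = alternating_form_swap[OF alternating]

lemma vol_cyclic: "vol v w u = vol u v w"
  using alternating unfolding alternating_form_def by blast

lemma eq_if_vol_eq:
  assumes "\<And>u v w. x * vol u v w = y * vol u v w"
  shows "x = y"
proof -
  have "x - y = 0" by (rule faithful) (simp only: left_diff_distrib assms diff_self)
  then show ?thesis by simp
qed

text \<open>
  The action on the volume form, by the Leibniz rule, of the endomorphism
  \<open>x \<mapsto> \<phi>(x) u\<close> of rank one. The result is again alternating, hence a multiple of the volume form. The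
  contraction identity says that the factor is the trace \<open>\<phi>(u)\<close>.
\<close>
definition insertion :: "('p \<Rightarrow> 's) \<Rightarrow> 'p \<Rightarrow> 'p \<Rightarrow> 'p \<Rightarrow> 'p \<Rightarrow> 's" where
  "insertion \<phi> u a b c = \<phi> a * vol u b c + \<phi> b * vol a u c + \<phi> c * vol a b u"

lemma alternating_insertion:
  assumes "module_hom sc (*) \<phi>"
  shows "alternating_form sc (insertion \<phi> u)"
proof -
  interpret \<phi>: module_hom sc "(*)" \<phi> by fact
  show ?thesis
  proof (rule alternating_formI)
    show "module sc" by (rule module_axioms)
    show "insertion \<phi> u a a c = 0" for a c
      unfolding insertion_def vol_simps vol_swap(1)[of u a c] by simp
    show "insertion \<phi> u c a a = 0" for a c
      unfolding insertion_def vol_simps vol_swap(2)[of c u a] by simp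
    show "insertion \<phi> u (a + a') b c = insertion \<phi> u a b c + insertion \<phi> u a' b c" for a a' b c
      unfolding insertion_def vol_simps \<phi>.add by (simp only: algebra_simps)
    show "insertion \<phi> u a (b + b') c = insertion \<phi> u a b c + insertion \<phi> u a b' c" for a b b' c
      unfolding insertion_def vol_simps \<phi>.add by (simp only: algebra_simps)
    show "insertion \<phi> u a b (c + c') = insertion \<phi> u a b c + insertion \<phi> u a b c'" for a b c c'
      unfolding insertion_def vol_simps \<phi>.add by (simp only: algebra_simps)
    show "insertion \<phi> u (sc s a) b c = s * insertion \<phi> u a b c" for s a b c
      unfolding insertion_def vol_simps \<phi>.scale by (simp only: algebra_simps)
  qed
qed

definition trace_factor :: "('p \<Rightarrow> 's) \<Rightarrow> 'p \<Rightarrow> 's" where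
  "trace_factor \<phi> u = (SOME k. \<forall>a b c. insertion \<phi> u a b c = k * vol a b c)"

lemma insertion_eq:
  assumes "module_hom sc (*) \<phi>"
  shows "insertion \<phi> u a b c = trace_factor \<phi> u * vol a b c"
  using someI_ex[OF universal[OF alternating_insertion[OF assms, of u]]]
  unfolding trace_factor_def by blast

text \<open>
  The endomorphisms \<open>E : x \<mapsto> \<phi>(x) v\<close> and \<open>F : x \<mapsto> \<psi>(x) u\<close> act on the volume form by scalars, so the
  commutator \<open>[E, F]\<close> acts by zero. As \<open>E F = \<phi>(u) (x \<mapsto> \<psi>(x) v)\<close> and \<open>F E = \<psi>(v) (x \<mapsto> \<phi>(x) u)\<close>, this gives
  the equation. In the computation the terms in which \<open>E\<close> and \<open>F\<close> act on different variables are
  symmetric and cancel.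
\<close>
lemma trace_factor_commute:
  assumes \<phi>: "module_hom sc (*) \<phi>" and \<psi>: "module_hom sc (*) \<psi>"
  shows "\<phi> u * trace_factor \<psi> v = \<psi> v * trace_factor \<phi> u"
proof (rule eq_if_vol_eq)
  fix a b c
  let ?cross = "\<lambda>\<phi> v \<psi> u. \<psi> a * (\<phi> b * vol u v c + \<phi> c * vol u b v)
    + \<psi> b * (\<phi> a * vol v u c + \<phi> c * vol a u v) + \<psi> c * (\<phi> a * vol v b u + \<phi> b * vol a v u)"
  \<comment> \<open>The remainder \<open>?cross\<close> collects the terms in which the two endomorphisms act on different variables.\<close>
  have expand: "trace_factor \<phi> v * (trace_factor \<psi> u * vol a b c)
      = \<phi> u * (trace_factor \<psi> v * vol a b c) + ?cross \<phi> v \<psi> u"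
    if \<phi>: "module_hom sc (*) \<phi>" and \<psi>: "module_hom sc (*) \<psi>" for \<phi> \<psi> u v
  proof -
    have "trace_factor \<phi> v * (trace_factor \<psi> u * vol a b c)
      = \<psi> a * (trace_factor \<phi> v * vol u b c) + \<psi> b * (trace_factor \<phi> v * vol a u c)
        + \<psi> c * (trace_factor \<phi> v * vol a b u)"
      unfolding insertion_eq[OF \<psi>, symmetric] by (simp add: insertion_def algebra_simps)
    also have "\<dots> = \<phi> u * insertion \<psi> v a b c + ?cross \<phi> v \<psi> u"
      unfolding insertion_eq[OF \<phi>, symmetric] by (simp add: insertion_def algebra_simps)
    finally show ?thesis unfolding insertion_eq[OF \<psi>] .
  qed
  have cross: "?cross \<phi> v \<psi> u = ?cross \<psi> u \<phi> v" by (simp add: algebra_simps)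
  have "\<phi> u * (trace_factor \<psi> v * vol a b c) + ?cross \<phi> v \<psi> u
      = trace_factor \<phi> v * (trace_factor \<psi> u * vol a b c)"
    by (rule expand[OF \<phi> \<psi>, symmetric])
  also have "\<dots> = trace_factor \<psi> u * (trace_factor \<phi> v * vol a b c)" by (rule mult.left_commute)
  also have "\<dots> = \<psi> v * (trace_factor \<phi> u * vol a b c) + ?cross \<phi> v \<psi> u"
    unfolding cross by (rule expand[OF \<psi> \<phi>])
  finally show "\<phi> u * trace_factor \<psi> v * vol a b c = \<psi> v * trace_factor \<phi> u * vol a b c"
    unfolding add_right_cancel mult.assoc .
qed

text \<open>
  Let \<open>m(\<phi>, v)\<close> be the difference of the two sides. By the previous lemma,
  \<open>\<phi>(u) m(\<psi>, v) = \<psi>(v) m(\<phi>, u)\<close>; and \<open>m(\<phi>, u) vol(v, b, c)\<close> is antisymmetric in \<open>u\<close> and \<open>v\<close>, since the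
  definition of the trace factor expresses it through terms that visibly are. For \<open>\<psi> = vol(\<cdot>, b, c)\<close> the
  two facts show that \<open>m(\<phi>, v) vol(a, b, c) vol(a', b', c')\<close> changes sign when \<open>a\<close> and \<open>a'\<close> are exchanged,
  and likewise for the other two pairs. Exchanging all three pairs changes the sign and swaps the two
  commuting factors. So twice the expression vanishes, hence the expression does, and as the
  values of the volume form generate the unit ideal, \<open>m(\<phi>, v) = 0\<close>.
\<close>
lemma trace_factor_eq:
  assumes \<phi>: "module_hom sc (*) \<phi>"
  shows "trace_factor \<phi> v = \<phi> v"
proof -
  let ?m = "\<lambda>\<phi> v. trace_factor \<phi> v - \<phi> v"
  have commute: "\<phi> u * ?m \<psi> v = \<psi> v * ?m \<phi> u"
    if "module_hom sc (*) \<phi>" "module_hom sc (*) \<psi>" for \<phi> \<psi> u v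
    using trace_factor_commute[OF that, of u v] by (simp add: algebra_simps)
  have antisym: "?m \<phi> u * vol v b c = - (?m \<phi> v * vol u b c)"
    if \<phi>: "module_hom sc (*) \<phi>" for \<phi> u v b c
  proof -
    have swap: "vol v u c = - vol u v c" "vol v b u = - vol u b v"
      by (rule vol_swap) (metis vol_swap minus_minus)
    have "trace_factor \<phi> u * vol v b c + trace_factor \<phi> v * vol u b c
        = \<phi> v * vol u b c + \<phi> u * vol v b c"
      unfolding insertion_eq[OF \<phi>, symmetric] insertion_def swap by simp
    then have "?m \<phi> u * vol v b c + ?m \<phi> v * vol u b c = 0"
      unfolding left_diff_distrib by (simp only: add_diff_add[symmetric] add.commute diff_self)
    then show ?thesis by (simp add: eq_neg_iff_add_eq_0)
  qed
  have vol_linear: "module_hom sc (*) (\<lambda>x. vol x b c)" for b c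
    by (rule linear_formI) (simp_all add: module_axioms vol_simps)
  define x where "x = ?m \<phi> v"
  have swap1: "x * vol a b c * vol a' b' c' = - (x * vol a' b c * vol a b' c')" for a b c a' b' c'
  proof -
    let ?\<psi> = "\<lambda>x. vol x b c"
    have move: "x * vol a b c = \<phi> v * ?m ?\<psi> a" for a
      using commute[OF vol_linear[of b c] \<phi>, of a v] by (simp add: x_def mult.commute)
    show ?thesis
      unfolding move using antisym[OF vol_linear[of b c], of a a' b' c']
      by (simp add: mult.assoc)
  qed
  have swap2: "x * vol a b c * vol a' b' c' = - (x * vol a b' c * vol a' b c')" for a b c a' b' c'
    using swap1[of b c a b' c' a'] unfolding vol_cyclic[of b c a] vol_cyclic[of b' c' a'] vol_cyclic[of b' c a] vol_cyclic[of b c' a'] .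
  have swap3: "x * vol a b c * vol a' b' c' = - (x * vol a b c' * vol a' b' c)" for a b c a' b' c'
    using swap1[of c a b c' a' b'] 
    unfolding vol_cyclic[of a b c, symmetric] vol_cyclic[of a' b' c', symmetric] vol_cyclic[of a b c', symmetric]
      vol_cyclic[of a' b' c, symmetric] .
  have "x * vol a b c * vol a' b' c' = 0" for a b c a' b' c'
  proof -
    have "x * vol a b c * vol a' b' c' = - (x * vol a' b' c' * vol a b c)"
      using swap1[of a b c a' b' c'] swap2[of a' b c a b' c'] swap3[of a' b' c a b c'] by simp
    then have "2 * (x * vol a b c * vol a' b' c') = 0" by (simp add: algebra_simps)
    then show ?thesis by (rule two_cancel[OF two_unit])
  qed
  then have "x = 0" by (blast intro: faithful)
  then show ?thesis by (simp add: x_def)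
qed

text \<open>
  The exterior product of the four vectors \<open>u, a, b, c\<close> is zero; this is the contraction of that
  identity with \<open>\<phi>\<close>.
\<close>
theorem contraction:
  assumes "module_hom sc (*) \<phi>"
  shows "\<phi> u * vol a b c = \<phi> a * vol u b c + \<phi> b * vol a u c + \<phi> c * vol a b u"
  using insertion_eq[OF assms, of u a b c] trace_factor_eq[OF assms, of u]
  by (simp add: insertion_def)

end


section \<open>Dual bases and traces\<close>

text \<open>
  A dual basis with an arbitrary finite index set: pairs of indices arise under restriction of
  scalars.
\<close>
definition dual_system ::
    "('a::comm_ring_1 \<Rightarrow> 'm::ab_group_add \<Rightarrow> 'm) \<Rightarrow> 'i set \<Rightarrow> ('i \<Rightarrow> 'm) \<Rightarrow> ('i \<Rightarrow> 'm \<Rightarrow> 'a) \<Rightarrow> bool" where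
  "dual_system sc I b \<phi> \<longleftrightarrow> finite I \<and> (\<forall>i\<in>I. module_hom sc (*) (\<phi> i)) \<and> (\<forall>x. (\<Sum>i\<in>I. sc (\<phi> i x) (b i)) = x)"

lemma dual_basis_iff: "dual_basis sc n b \<phi> \<longleftrightarrow> dual_system sc {..<n} b \<phi>"
  by (auto simp: dual_basis_def dual_system_def linear_forms_def)

lemma dual_system_expand:
  assumes "dual_system sc I b \<phi>" "module_hom sc (*) f"
  shows "(\<Sum>i\<in>I. \<phi> i x * f (b i)) = f x"
proof -
  interpret f: module_hom sc "(*)" f by fact
  have "f x = f (\<Sum>i\<in>I. sc (\<phi> i x) (b i))" using assms(1) by (simp add: dual_system_def)
  then show ?thesis by (simp add: f.sum f.scale)
qed

text \<open>
  Each side is the double sum \<open>\<Sum>\<^sub>i \<Sum>\<^sub>j \<phi>\<^sub>i(c\<^sub>j) \<psi>\<^sub>j(g(b\<^sub>i))\<close>, summed in one order or the other.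
\<close>
lemma trace_dual_system_unique:
  assumes \<phi>: "dual_system sc I b \<phi>" and \<psi>: "dual_system sc J c \<psi>" and g: "module_hom sc sc g"
  shows "(\<Sum>i\<in>I. \<phi> i (g (b i))) = (\<Sum>j\<in>J. \<psi> j (g (c j)))"
proof -
  have comp: "module_hom sc (*) (\<lambda>x. \<psi> j (g x))" if "j \<in> J" for j
    using module_hom_compose[OF g, of "(*)" "\<psi> j"] \<psi> that by (simp add: dual_system_def comp_def)
  have "(\<Sum>i\<in>I. \<phi> i (g (b i))) = (\<Sum>i\<in>I. \<Sum>j\<in>J. \<psi> j (g (b i)) * \<phi> i (c j))"
    using dual_system_expand[OF \<psi>] \<phi> by (intro sum.cong) (auto simp: dual_system_def)
  also have "\<dots> = (\<Sum>j\<in>J. \<Sum>i\<in>I. \<phi> i (c j) * \<psi> j (g (b i)))"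
    by (subst sum.swap) (simp add: mult.commute)
  also have "\<dots> = (\<Sum>j\<in>J. \<psi> j (g (c j)))"
    using dual_system_expand[OF \<phi> comp] by (intro sum.cong) auto
  finally show ?thesis .
qed

lemma module_trace_eq:
  assumes "dual_basis sc n b \<phi>" "module_hom sc sc g"
  shows "module_trace sc g = (\<Sum>i<n. \<phi> i (g (b i)))"
  unfolding module_trace_def
proof (rule the_equality)
  show "\<exists>m c \<psi>. dual_basis sc m c \<psi> \<and> (\<Sum>i<n. \<phi> i (g (b i))) = (\<Sum>i<m. \<psi> i (g (c i)))"
    using assms by blast
  show "t = (\<Sum>i<n. \<phi> i (g (b i)))"
    if ex: "\<exists>m c \<psi>. dual_basis sc m c \<psi> \<and> t = (\<Sum>i<m. \<psi> i (g (c i)))" for t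
  proof -
    obtain m c \<psi> where c: "dual_basis sc m c \<psi>" and t: "t = (\<Sum>i<m. \<psi> i (g (c i)))"
      using ex by blast
    show ?thesis unfolding t
      by (rule trace_dual_system_unique[OF c[unfolded dual_basis_iff] assms(1)[unfolded dual_basis_iff] assms(2)])
  qed
qed

text \<open>
  A bijective endomorphism \<open>f\<close> transports the dual system, and the trace may be computed in the
  transported one.
\<close>
lemma trace_conjugate:
  assumes \<phi>: "dual_system sc I b \<phi>" and f: "module_hom sc sc f" "bij f" and g: "module_hom sc sc g"
    and g': "module_hom sc sc g'" and conj: "\<And>x. g' (f x) = f (g x)"
  shows "(\<Sum>i\<in>I. \<phi> i (g' (b i))) = (\<Sum>i\<in>I. \<phi> i (g (b i)))"
proof -
  interpret f: module_hom sc sc f by fact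
  have inv: "inv f (f x) = x" "f (inv f x) = x" for x
    using f(2) by (simp_all add: bij_is_inj bij_is_surj surj_f_inv_f)
  have inv_lin: "module_hom sc sc (inv f)"
  proof -
    have "inv f (x + y) = inv f x + inv f y" for x y
      using arg_cong[OF f.add[of "inv f x" "inv f y"], of "inv f"] unfolding inv by (rule sym)
    moreover have "inv f (sc c x) = sc c (inv f x)" for c x
      using arg_cong[OF f.scale[of c "inv f x"], of "inv f"] unfolding inv by (rule sym)
    ultimately show ?thesis using f.m1.module_axioms by (simp add: module_hom_iff)
  qed
  have "dual_system sc I (\<lambda>i. f (b i)) (\<lambda>i x. \<phi> i (inv f x))"
    unfolding dual_system_def
  proof (intro conjI ballI allI)
    show "finite I" using \<phi> by (simp add: dual_system_def)
    show "module_hom sc (*) (\<lambda>x. \<phi> i (inv f x))" if "i \<in> I" for i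
      using module_hom_compose[OF inv_lin, of "(*)" "\<phi> i"] \<phi> that by (simp add: dual_system_def comp_def)
    show "(\<Sum>i\<in>I. sc (\<phi> i (inv f x)) (f (b i))) = x" for x
    proof -
      have "(\<Sum>i\<in>I. sc (\<phi> i (inv f x)) (f (b i))) = f (\<Sum>i\<in>I. sc (\<phi> i (inv f x)) (b i))"
        by (simp add: f.sum f.scale)
      also have "\<dots> = x" using \<phi> by (simp add: dual_system_def inv)
      finally show ?thesis .
    qed
  qed
  from trace_dual_system_unique[OF \<phi> this g'] show ?thesis by (simp add: conj inv)
qed

section \<open>Hermitian forms and the cross product\<close>

locale hermitian_form = module sc
  for sc :: "'s::comm_ring_1 \<Rightarrow> 'p::ab_group_add \<Rightarrow> 'p" +
  fixes cj :: "'s \<Rightarrow> 's" and h :: "'p \<Rightarrow> 'p \<Rightarrow> 's"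
  assumes cj_morphism: "ring_morphism cj" and cj_cj [simp]: "cj (cj x) = x"
    and hermitian: "nondegenerate_hermitian cj sc h"
begin

lemma cj_simps: "cj (x + y) = cj x + cj y" "cj (x * y) = cj x * cj y" "cj 0 = 0" "cj 1 = 1"
    "cj (- x) = - cj x" "cj (x - y) = cj x - cj y"
proof -
  show add: "cj (x + y) = cj x + cj y" "cj (x * y) = cj x * cj y" "cj 1 = 1" for x y
    using cj_morphism by (simp_all add: ring_morphism_def)
  show zero: "cj 0 = 0" using add(1)[of 0 0] by simp
  show neg: "cj (- x) = - cj x" for x
    using add(1)[of x "- x"] by (simp add: zero eq_neg_iff_add_eq_0 add.commute)
  show "cj (x - y) = cj x - cj y" using add(1)[of x "- y"] by (simp add: neg)
qed

lemma cj_sum: "cj (sum f A) = (\<Sum>x\<in>A. cj (f x))"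
  by (induction A rule: infinite_finite_induct) (simp_all add: cj_simps)

lemma h_form: "module_hom sc (*) (\<lambda>u. h u w)"
  using hermitian unfolding nondegenerate_hermitian_def by blast

lemma h_simps: "h (u + u') w = h u w + h u' w" "h u (w + w') = h u w + h u w'"
    "h (sc c u) w = c * h u w" "h u (sc c w) = cj c * h u w"
proof -
  show "h u (w + w') = h u w + h u w'" "h u (sc c w) = cj c * h u w"
    using hermitian unfolding nondegenerate_hermitian_def by blast+
qed (rule module_hom.add[OF h_form] module_hom.scale[OF h_form])+

lemma cj_h: "cj (h u w) = h w u"
  using hermitian unfolding nondegenerate_hermitian_def by (blast intro: sym)

lemma h_bij: "bij_betw (\<lambda>w u. h u w) UNIV (linear_forms sc)"
  using hermitian unfolding nondegenerate_hermitian_def by blast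

lemma h_zero: "h u 0 = 0" "h 0 u = 0"
  using h_simps(1)[of 0 0] h_simps(2)[of _ 0 0] by simp_all

lemma h_diff: "h u (w - w') = h u w - h u w'"
  using h_simps(2)[of u "w - w'" w'] by (simp add: eq_diff_eq)

lemma represent:
  assumes "module_hom sc (*) f"
  obtains w where "\<And>u. h u w = f u"
proof -
  have "f \<in> range (\<lambda>w u. h u w)"
    using h_bij assms by (simp add: bij_betw_def linear_forms_def)
  then show ?thesis using that by auto
qed

lemma h_cancel: "(\<And>u. h u x = h u y) \<Longrightarrow> x = y"
  using h_bij by (intro injD[of "\<lambda>w u. h u w"]) (auto simp: bij_betw_def)

end

text \<open>
  The isometry condition is spelled out as a Gram determinant, expanded along its first row.
\<close>
locale hermitian_volume = volume_form sc vol + hermitian_form sc cj h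
  for sc :: "'s::comm_ring_1 \<Rightarrow> 'p::ab_group_add \<Rightarrow> 'p" and vol cj h +
  assumes vol_isometry: "vol a b c * cj (vol p q r)
      = h a p * (h b q * h c r - h b r * h c q) - h a q * (h b p * h c r - h b r * h c p)
        + h a r * (h b p * h c q - h b q * h c p)"
begin

definition cross :: "'p \<Rightarrow> 'p \<Rightarrow> 'p" where
  "cross v w = (THE x. \<forall>u. h u x = vol u v w)"

lemma h_cross: "h u (cross v w) = vol u v w"
proof -
  have "module_hom sc (*) (\<lambda>u. vol u v w)"
    by (rule linear_formI) (simp_all add: module_axioms vol_simps)
  from represent[OF this] obtain x where x: "\<And>u. h u x = vol u v w" by blast
  have "\<forall>u. h u (cross v w) = vol u v w" unfolding cross_def
  proof (rule theI[of _ x])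
    show "\<forall>u. h u x = vol u v w" using x by simp
    show "y = x" if "\<forall>u. h u y = vol u v w" for y
      by (rule h_cancel) (simp add: that x)
  qed
  then show ?thesis by blast
qed

lemma cj_vol: "cj (vol u v w) = h (cross v w) u"
  by (simp only: cj_h flip: h_cross)

lemma cross_simps: "cross (u + u') w = cross u w + cross u' w" "cross u (w + w') = cross u w + cross u w'"
    "cross (sc c u) w = sc (cj c) (cross u w)" "cross u (sc c w) = sc (cj c) (cross u w)"
    "cross u u = 0"
  by (rule h_cancel, simp add: h_cross h_simps vol_simps h_zero)+

lemma cross_swap: "cross w u = - cross u w"
  by (rule antisymmetric_of_alternating) (simp_all add: cross_simps)

text \<open>
  The triple product expansion. It is enough to compare \<open>vol(u \<times> v, w, x)\<close> with
  \<open>h(w, u) h(x, v) - h(w, v) h(x, u)\<close>, and this may be done after multiplication by the conjugate of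
  \<open>vol(a, b, c)\<close>. The isometry turns the first product into a determinant with first row
  \<open>h(u \<times> v, \<cdot>)\<close>, the conjugate of \<open>vol(\<cdot>, u, v)\<close>. Two applications of the contraction identity, with the
  linear forms \<open>h(\<cdot>, w)\<close> and \<open>h(\<cdot>, x)\<close>, transform the second product into the same determinant.
\<close>
theorem cross_cross: "cross (cross u v) w = sc (h u w) v - sc (h v w) u"
proof (rule h_cancel)
  fix x
  let ?W = "\<lambda>a. h a w" and ?X = "\<lambda>a. h a x"
  have cj_cancel: "s = t" if "\<And>a b c. s * cj (vol a b c) = t * cj (vol a b c)" for s t
  proof -
    have "cj s * vol a b c = cj t * vol a b c" for a b c
      using arg_cong[OF that[of a b c], of cj] by (simp add: cj_simps)
    then have "cj s = cj t" by (rule eq_if_vol_eq)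
    then show ?thesis by (metis cj_cj)
  qed
  have "vol (cross u v) w x = h w u * h x v - h w v * h x u"
  proof (rule cj_cancel)
    fix a b c
    have W: "?W y * vol a b c = ?W a * vol b c y + ?W b * vol c a y + ?W c * vol a b y" for y
      using contraction[OF h_form, of y w a b c] by (simp only: vol_cyclic[of b c y] vol_cyclic[of a y c])
    have "(?W u * ?X v - ?W v * ?X u) * vol a b c
      = ?X v * (?W u * vol a b c) - ?X u * (?W v * vol a b c)" by (simp add: algebra_simps)
    also have "\<dots> = ?W a * (?X v * vol b c u - ?X u * vol b c v) + ?W b * (?X v * vol c a u - ?X u * vol c a v)
        + ?W c * (?X v * vol a b u - ?X u * vol a b v)"
      unfolding W by (simp add: algebra_simps)
    also have "\<dots> = ?W a * (?X b * vol c u v - ?X c * vol b u v) + ?W b * (?X c * vol a u v - ?X a * vol c u v)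
        + ?W c * (?X a * vol b u v - ?X b * vol a u v)"
    proof -
      have X: "?X v * vol b c u - ?X u * vol b c v = ?X b * vol c u v - ?X c * vol b u v" for b c
      proof -
        have "?X v * vol b c u = ?X b * vol v c u + ?X c * vol b v u + ?X u * vol b c v"
          by (rule contraction[OF h_form])
        moreover have "vol v c u = vol c u v" "vol b v u = - vol b u v"
          by (rule vol_cyclic[symmetric], rule vol_swap)
        ultimately show ?thesis by simp
      qed
      show ?thesis unfolding X ..
    qed
    also have "\<dots> = vol a u v * (?W b * ?X c - ?W c * ?X b) - vol b u v * (?W a * ?X c - ?W c * ?X a)
       + vol c u v * (?W a * ?X b - ?W b * ?X a)" by (simp add: algebra_simps)
    finally have "cj (vol a u v * (?W b * ?X c - ?W c * ?X b) - vol b u v * (?W a * ?X c - ?W c * ?X a)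
       + vol c u v * (?W a * ?X b - ?W b * ?X a)) = cj ((?W u * ?X v - ?W v * ?X u) * vol a b c)"
      by (rule arg_cong[OF sym])
    then show "vol (cross u v) w x * cj (vol a b c) = (h w u * h x v - h w v * h x u) * cj (vol a b c)"
      unfolding vol_isometry by (simp only: cj_simps cj_h cj_vol)
  qed
  moreover have "vol x (cross u v) w = vol (cross u v) w x"
    by (rule vol_cyclic[symmetric])
  ultimately show "h x (cross (cross u v) w) = h x (sc (h u w) v - sc (h v w) u)"
    by (simp add: h_cross h_diff h_simps cj_h)
qed

text \<open>
  The trace of the identity. Putting \<open>u = b\<^sub>i\<close> and \<open>\<phi> = \<phi>\<^sub>i\<close> in the contraction identity and summing
  over \<open>i\<close> turns each of the three terms on its right into \<open>vol(x, y, z)\<close>.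
\<close>
lemma rank_eq_3:
  assumes \<phi>: "dual_system sc I b \<phi>"
  shows "(\<Sum>i\<in>I. \<phi> i (b i)) = 3"
proof (rule eq_if_vol_eq)
  fix x y z
  have lin: "module_hom sc (*) (\<lambda>u. vol u y z)" "module_hom sc (*) (\<lambda>u. vol x u z)"
    "module_hom sc (*) (\<lambda>u. vol x y u)"
    by (rule linear_formI; simp add: module_axioms vol_simps)+
  have "(\<Sum>i\<in>I. \<phi> i (b i)) * vol x y z
    = (\<Sum>i\<in>I. \<phi> i x * vol (b i) y z + \<phi> i y * vol x (b i) z + \<phi> i z * vol x y (b i))"
    unfolding sum_distrib_right
    using \<phi> by (intro sum.cong refl contraction) (auto simp: dual_system_def)
  also have "\<dots> = vol x y z + vol x y z + vol x y z"
    using dual_system_expand[OF \<phi> lin(1), of x] dual_system_expand[OF \<phi> lin(2), of y]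
      dual_system_expand[OF \<phi> lin(3), of z] by (simp add: sum.distrib)
  finally show "(\<Sum>i\<in>I. \<phi> i (b i)) * vol x y z = 3 * vol x y z" by simp
qed

text \<open>
  The operator \<open>x \<mapsto> (x \<times> u) \<times> v\<close> is \<open>x \<mapsto> h(x, v) u - h(u, v) x\<close>, of trace \<open>h(u, v) - 3 h(u, v)\<close>. In this
  way the form is visible in the multiplication of the vector algebra.
\<close>
lemma trace_cross_cross:
  assumes \<phi>: "dual_system sc I b \<phi>"
  shows "(\<Sum>i\<in>I. \<phi> i (cross (cross (b i) u) v)) = - (2 * h u v)"
proof -
  have "\<phi> i (cross (cross (b i) u) v) = \<phi> i u * h (b i) v - h u v * \<phi> i (b i)" if "i \<in> I" for i
  proof -
    interpret \<phi>: module_hom sc "(*)" "\<phi> i" using \<phi> that by (simp add: dual_system_def)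
    show ?thesis by (simp add: cross_cross \<phi>.diff \<phi>.scale mult.commute)
  qed
  then have "(\<Sum>i\<in>I. \<phi> i (cross (cross (b i) u) v))
      = (\<Sum>i\<in>I. \<phi> i u * h (b i) v) - h u v * (\<Sum>i\<in>I. \<phi> i (b i))"
    by (simp add: sum_subtractf sum_distrib_left)
  also have "\<dots> = h u v - h u v * 3"
    by (simp only: dual_system_expand[OF \<phi> h_form] rank_eq_3[OF \<phi>])
  finally show ?thesis by simp
qed

text \<open>
  The cross products generate the module additively: if \<open>\<phi>\<^sub>i = h(\<cdot>, w\<^sub>i)\<close>, then
  \<open>\<Sum>\<^sub>i (b\<^sub>i \<times> x) \<times> w\<^sub>i = 3 x - x = 2 x\<close>, and two is invertible.
\<close>
lemma additive_eq_0_if_cross: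
  fixes g :: "'p \<Rightarrow> 'r::ab_group_add"
  assumes \<phi>: "dual_system sc I b \<phi>"
    and add: "\<And>u v. g (u + v) = g u + g v" and cross: "\<And>u v. g (cross u v) = 0"
  shows "g v = 0"
proof -
  obtain c :: 's where c: "1 = 2 * c" using two_unit by (rule dvdE)
  have "\<forall>i\<in>I. \<exists>w. \<forall>u. h u w = \<phi> i u"
    using \<phi> represent by (metis dual_system_def)
  then obtain w where w: "\<And>i u. i \<in> I \<Longrightarrow> h u (w i) = \<phi> i u" by metis
  have double: "(\<Sum>i\<in>I. cross (cross (b i) x) (w i)) = x + x" for x
  proof -
    have "(\<Sum>i\<in>I. cross (cross (b i) x) (w i)) = (\<Sum>i\<in>I. sc (\<phi> i (b i)) x - sc (\<phi> i x) (b i))"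
      by (intro sum.cong refl) (simp add: cross_cross w)
    also have "\<dots> = sc 3 x - x"
      using \<phi> by (simp add: sum_subtractf flip: scale_sum_left rank_eq_3[OF \<phi>]) (simp add: dual_system_def)
    also have "sc 3 x = sc (1 + 1 + 1) x" by simp
    also have "\<dots> = x + x + x" by (simp only: scale_left_distrib scale_one)
    finally show ?thesis by simp
  qed
  have g0: "g 0 = 0" using add[of 0 0] by simp
  have g_sum: "g (\<Sum>i\<in>J. f i) = (\<Sum>i\<in>J. g (f i))" for J :: "'i set" and f
    by (induction J rule: infinite_finite_induct) (simp_all add: add g0)
  have v: "v = sc c v + sc c v"
    using scale_one[of v] unfolding c by (simp only: mult_2 scale_left_distrib)
  have "g v = g (\<Sum>i\<in>I. cross (cross (b i) (sc c v)) (w i))" unfolding double by (subst v) (rule refl)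
  then show ?thesis by (simp add: g_sum cross)
qed

end


section \<open>The third exterior power\<close>

lemma vector_eta: "vector [u $ 1, u $ 2, u $ 3] = (u :: 'p::zero ^ 3)"
  by (simp add: vec_eq_iff forall_3)

lemma vec_upd_vector:
  fixes u v w x :: "'p::zero"
  shows "vec_upd (vector [u, v, w] :: 'p ^ 3) 1 x = vector [x, v, w]"
    and "vec_upd (vector [u, v, w] :: 'p ^ 3) 2 x = vector [u, x, w]"
    and "vec_upd (vector [u, v, w] :: 'p ^ 3) 3 x = vector [u, v, x]"
  by (simp_all add: vec_upd_def vec_eq_iff forall_3)

definition gram_det :: "('p \<Rightarrow> 'p \<Rightarrow> 's::comm_ring_1) \<Rightarrow> 'p ^ 3 \<Rightarrow> 'p ^ 3 \<Rightarrow> 's" where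
  "gram_det h u v = det (\<chi> i j. h (u $ i) (v $ j))"

lemma gram_det_expand:
  "gram_det h u v
     = h (u $ 1) (v $ 1) * (h (u $ 2) (v $ 2) * h (u $ 3) (v $ 3) - h (u $ 2) (v $ 3) * h (u $ 3) (v $ 2))
     - h (u $ 1) (v $ 2) * (h (u $ 2) (v $ 1) * h (u $ 3) (v $ 3) - h (u $ 2) (v $ 3) * h (u $ 3) (v $ 1))
     + h (u $ 1) (v $ 3) * (h (u $ 2) (v $ 1) * h (u $ 3) (v $ 2) - h (u $ 2) (v $ 2) * h (u $ 3) (v $ 1))"
  unfolding gram_det_def det_3 by (simp add: algebra_simps)

lemma free_det_form_eq_lift:
  "free_det_form cj h x y
     = free_lift (\<lambda>u. \<Sum>v\<in>Poly_Mapping.keys y. cj (Poly_Mapping.lookup y v) * gram_det h u v) x"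
  unfolding free_det_form_def free_lift_def gram_det_def
  by (simp add: sum_distrib_left mult.assoc)

context hermitian_form begin

lemma alternating_gram: "alternating_form sc (\<lambda>a b c. gram_det h (vector [a, b, c]) v)"
  by (rule alternating_formI[OF module_axioms])
     (simp_all add: gram_det_expand h_simps algebra_simps)

lemma cj_gram: "cj (gram_det h u v) = gram_det h v u"
  by (simp only: gram_det_expand cj_simps cj_h) (simp add: algebra_simps)

lemma free_det_form_sym: "cj (free_det_form cj h x y) = free_det_form cj h y x"
proof -
  have "cj (free_det_form cj h x y) = (\<Sum>u\<in>Poly_Mapping.keys x. \<Sum>v\<in>Poly_Mapping.keys y.
      Poly_Mapping.lookup y v * cj (Poly_Mapping.lookup x u) * gram_det h v u)"
    unfolding free_det_form_def gram_det_def[symmetric]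
    by (simp only: cj_sum cj_simps cj_gram cj_cj mult_ac)
  then show ?thesis unfolding free_det_form_def gram_det_def[symmetric]
    by (subst (asm) sum.swap)
qed

lemma alternating_combination:
  assumes "\<And>v. v \<in> K \<Longrightarrow> alternating_form sc (F v)"
  shows "alternating_form sc (\<lambda>a b c. \<Sum>v\<in>K. k v * F v a b c)"
proof (rule alternating_formI[OF module_axioms], goal_cases)
  case (1 u u' v w) show ?case unfolding sum.distrib[symmetric]
    by (rule sum.cong) (simp_all add: alternating_formD[OF assms] distrib_left)
next
  case (2 u u' v w) show ?case unfolding sum.distrib[symmetric]
    by (rule sum.cong) (simp_all add: alternating_formD[OF assms] distrib_left)
next
  case (3 u u' v w) show ?case unfolding sum.distrib[symmetric]
    by (rule sum.cong) (simp_all add: alternating_formD[OF assms] distrib_left)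
next
  case (4 c u v w) show ?case unfolding sum_distrib_left
    by (rule sum.cong) (simp_all add: alternating_formD[OF assms] mult.left_commute)
qed (simp_all add: alternating_formD[OF assms])

text \<open>
  For a fixed second argument, the determinant form is a linear combination of the alternating forms
  given by Gram determinants. Therefore it depends on the class of its first argument only;
  hermitian symmetry then gives the same for the second (\<open>ext3_form_class\<close>).
\<close>
lemma free_det_form_cong:
  assumes "x' - x \<in> ext3_relations sc"
  shows "free_det_form cj h x' y = free_det_form cj h x y"
proof -
  let ?F = "\<lambda>a b c. \<Sum>v\<in>Poly_Mapping.keys y. cj (Poly_Mapping.lookup y v) * gram_det h (vector [a, b, c]) v"
  have eq: "free_det_form cj h x y = free_lift (of_triple ?F) x" for x
    unfolding free_det_form_eq_lift vector_eta ..
  interpret L: module_hom free_scale "(*)" "free_lift (of_triple ?F)" by (rule free_lift_linear)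
  have "free_lift (of_triple ?F) (x' - x) = 0"
    by (rule free_lift_relations[OF alternating_combination assms]) (rule alternating_gram)
  then show ?thesis unfolding eq by (simp add: L.diff)
qed

lemma ext3_form_class:
  "ext3_form cj h (ext3_class sc x) (ext3_class sc y) = free_det_form cj h x y"
proof -
  have invariant: "free_det_form cj h x' y' = free_det_form cj h x y"
    if "x' \<in> ext3_class sc x" "y' \<in> ext3_class sc y" for x' y'
  proof -
    have "free_det_form cj h x' y' = free_det_form cj h x y'"
      using that by (intro free_det_form_cong) (simp add: ext3_class_def)
    also have "\<dots> = cj (free_det_form cj h y' x)" by (rule free_det_form_sym[symmetric])
    also have "free_det_form cj h y' x = free_det_form cj h y x"
      using that by (intro free_det_form_cong) (simp add: ext3_class_def)
    also have "cj \<dots> = free_det_form cj h x y" by (rule free_det_form_sym)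
    finally show ?thesis .
  qed
  interpret free: module "free_scale :: 's \<Rightarrow> (('p ^ 3) \<Rightarrow>\<^sub>0 's) \<Rightarrow> _" by (rule module_free_scale)
  have self: "z \<in> ext3_class sc z" for z
    by (simp add: ext3_class_def ext3_relations_def free.span_zero)
  show ?thesis unfolding ext3_form_def
  proof (rule the_equality)
    show "\<exists>x'\<in>ext3_class sc x. \<exists>y'\<in>ext3_class sc y. free_det_form cj h x y = free_det_form cj h x' y'"
      using self by blast
    show "z = free_det_form cj h x y"
      if "\<exists>x'\<in>ext3_class sc x. \<exists>y'\<in>ext3_class sc y. z = free_det_form cj h x' y'" for z
      using that invariant by blast
  qed
qed

text \<open>
  The kernel of the linear map \<open>A\<close> from the free module that \<open>\<alpha>\<close> induces is exactly the module of
  relations. Choose \<open>\<tau>\<close> with \<open>A \<tau> = 1\<close>. Since \<open>x - A(x) \<tau>\<close> is a relation for all \<open>x\<close>, the linear extension of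
  an alternating form is its value at \<open>\<tau>\<close> times \<open>A\<close>, which is the universal property of a volume form.
  Expanding \<open>A \<tau> = 1\<close> writes one as a combination of values of the volume form.
\<close>
lemma hermitian_volume_of_trivialization:
  assumes two: "(2 :: 's) dvd 1" and \<alpha>: "det_trivialization cj sc h \<alpha>"
  shows "hermitian_volume sc (\<lambda>u v w. \<alpha> (wedge3 sc u v w)) cj h"
proof -
  define A where "A x = \<alpha> (ext3_class sc x)" for x
  define vol where "vol u v w = A (Poly_Mapping.single (vector [u, v, w]) 1)" for u v w
  have vol_eq: "(\<lambda>u v w. \<alpha> (wedge3 sc u v w)) = vol"
    by (simp add: fun_eq_iff vol_def A_def wedge3_def)
  have A_lin: "module_hom free_scale (*) A"
    using \<alpha> unfolding det_trivialization_def A_def by blast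
  interpret A: module_hom free_scale "(*)" A by (rule A_lin)
  have bij: "bij_betw \<alpha> (ext3 sc) UNIV" using \<alpha> by (simp add: det_trivialization_def)
  have rel_subspace: "A.m1.subspace (ext3_relations sc)"
    unfolding ext3_relations_def by (rule A.m1.subspace_span)
  have kernel: "A x = 0 \<longleftrightarrow> x \<in> ext3_relations sc" for x
  proof
    assume "A x = 0"
    then have "\<alpha> (ext3_class sc x) = \<alpha> (ext3_class sc 0)" using A.zero by (simp add: A_def)
    then have "ext3_class sc x = ext3_class sc 0"
      using bij by (auto simp: bij_betw_def ext3_def dest: inj_onD)
    moreover have "x \<in> ext3_class sc x"
      using rel_subspace by (simp add: ext3_class_def A.m1.subspace_0)
    ultimately show "x \<in> ext3_relations sc" by (auto simp: ext3_class_def)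
  next
    assume x: "x \<in> ext3_relations sc"
    have "ext3_class sc x = ext3_class sc 0"
      unfolding ext3_class_def
      using A.m1.subspace_diff[OF rel_subspace _ x] A.m1.subspace_add[OF rel_subspace _ x]
      by (force)
    then show "A x = 0" using A.zero by (simp add: A_def)
  qed
  have additive: "vec_upd u i (x + y) = p \<Longrightarrow> vec_upd u i x = q \<Longrightarrow> vec_upd u i y = r \<Longrightarrow>
      A (Poly_Mapping.single p 1) = A (Poly_Mapping.single q 1) + A (Poly_Mapping.single r 1)"
    for u :: "'p ^ 3" and i x y p q r
  proof -
    have "A (Poly_Mapping.single (vec_upd u i (x + y)) 1 - Poly_Mapping.single (vec_upd u i x) 1
        - Poly_Mapping.single (vec_upd u i y) 1) = 0"
      unfolding kernel ext3_relations_def by (rule A.m1.span_base) blast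
    then show "vec_upd u i (x + y) = p \<Longrightarrow> vec_upd u i x = q \<Longrightarrow> vec_upd u i y = r \<Longrightarrow> ?thesis"
      by (simp add: A.diff diff_eq_eq add.commute)
  qed
  have homogeneous: "A (Poly_Mapping.single (vec_upd u i (sc c x)) 1)
      = c * A (Poly_Mapping.single (vec_upd u i x) 1)" for u :: "'p ^ 3" and i x c
  proof -
    have "A (Poly_Mapping.single (vec_upd u i (sc c x)) 1
        - free_scale c (Poly_Mapping.single (vec_upd u i x) 1)) = 0"
      unfolding kernel ext3_relations_def by (rule A.m1.span_base) blast
    then show ?thesis by (simp add: A.diff A.scale)
  qed
  have alternates: "A (Poly_Mapping.single u 1) = 0" if "i \<noteq> j" "u $ i = u $ j" for u :: "'p ^ 3" and i j
    unfolding kernel ext3_relations_def using that by (intro A.m1.span_base) blast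
  have vol_alt: "alternating_form sc vol"
  proof (rule alternating_formI[OF module_axioms])
    show "vol (u + u') v w = vol u v w + vol u' v w" for u u' v w
      unfolding vol_def by (rule additive[of "vector [u, v, w]" 1 u u']) (rule vec_upd_vector)+
    show "vol u (v + v') w = vol u v w + vol u v' w" for u v v' w
      unfolding vol_def by (rule additive[of "vector [u, v, w]" 2 v v']) (rule vec_upd_vector)+
    show "vol u v (w + w') = vol u v w + vol u v w'" for u v w w'
      unfolding vol_def by (rule additive[of "vector [u, v, w]" 3 w w']) (rule vec_upd_vector)+
    show "vol (sc c u) v w = c * vol u v w" for c u v w
      using homogeneous[of "vector [u, v, w]" 1 c u] by (simp add: vec_upd_vector vol_def)
    show "vol u u w = 0" "vol w u u = 0" for u w
      unfolding vol_def by (rule alternates[of 1 2] alternates[of 2 3]; simp)+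
  qed
  have A_single: "A (Poly_Mapping.single u 1) = of_triple vol u" for u :: "'p ^ 3"
    by (simp add: vol_def vector_eta)
  have A_eq: "A x = free_lift (of_triple vol) x" for x
    using free_lift_unique[OF A_lin, of x] by (simp add: A_single)
  obtain \<tau> where \<tau>: "A \<tau> = 1"
  proof -
    have "1 \<in> \<alpha> ` ext3 sc" using bij by (simp add: bij_betw_def)
    then show ?thesis using that by (auto simp: ext3_def A_def)
  qed
  have "hermitian_volume sc vol cj h"
  proof unfold_locales
    show "(2 :: 's) dvd 1" "alternating_form sc vol" by fact+
    show "\<exists>k. \<forall>u v w. F u v w = k * vol u v w" if F: "alternating_form sc F" for F
    proof (intro exI allI)
      fix u v w
      let ?x = "Poly_Mapping.single (vector [u, v, w]) 1 :: ('p ^ 3) \<Rightarrow>\<^sub>0 's"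
      interpret L: module_hom free_scale "(*)" "free_lift (of_triple F)" by (rule free_lift_linear)
      have "A (?x - free_scale (A ?x) \<tau>) = 0" by (simp add: A.diff A.scale \<tau>)
      then have "free_lift (of_triple F) (?x - free_scale (A ?x) \<tau>) = 0"
        unfolding kernel by (rule free_lift_relations[OF F])
      then show "F u v w = free_lift (of_triple F) \<tau> * vol u v w"
        by (simp add: L.diff L.scale vol_def mult.commute)
    qed
    show "x = 0" if "\<And>u v w. x * vol u v w = 0" for x
    proof -
      have zero: "x * (k * vol u v w) = 0" for k u v w
        using that[of u v w] by (simp only: mult.left_commute[of x] mult_zero_right)
      have "x = x * free_lift (of_triple vol) \<tau>" using \<tau> by (simp add: A_eq)
      also have "\<dots> = 0" unfolding free_lift_def sum_distrib_left zero by simp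
      finally show ?thesis .
    qed
    show "vol a b c * cj (vol p q r)
      = h a p * (h b q * h c r - h b r * h c q) - h a q * (h b p * h c r - h b r * h c p)
        + h a r * (h b p * h c q - h b q * h c p)" for a b c p q r
    proof -
      have "vol a b c * cj (vol p q r) = ext3_form cj h (wedge3 sc a b c) (wedge3 sc p q r)"
        using \<alpha> unfolding det_trivialization_def vol_eq[symmetric] by (simp add: wedge3_def ext3_def)
      also have "\<dots> = gram_det h (vector [a, b, c]) (vector [p, q, r])"
        unfolding wedge3_def ext3_form_class free_det_form_eq_lift by (simp add: cj_simps)
      finally show ?thesis by (simp add: gram_det_expand)
    qed
  qed
  then show ?thesis by (simp add: vol_eq)
qed

end


section \<open>Localization and injectivity of the structure map\<close>

text \<open>
  An ideal that contains \<open>I\<close> and is maximal among the proper ones is prime.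
\<close>
lemma exists_prime_ideal:
  fixes I :: "'a::comm_ring_1 set"
  assumes I: "module.subspace (*) I" "1 \<notin> I"
  shows "\<exists>p. prime_ideal p \<and> I \<subseteq> p"
proof -
  interpret R: module "(*) :: 'a \<Rightarrow> 'a \<Rightarrow> 'a" by (rule module_ring)
  let ?A = "{J. R.subspace J \<and> 1 \<notin> J \<and> I \<subseteq> J}"
  have "\<exists>p\<in>?A. \<forall>J\<in>?A. p \<subseteq> J \<longrightarrow> J = p"
  proof (rule subset_Zorn_nonempty)
    show "?A \<noteq> {}" using I by auto
    fix C assume C: "C \<noteq> {}" "subset.chain ?A C"
    then have CA: "C \<subseteq> ?A" and total: "\<And>J K. J \<in> C \<Longrightarrow> K \<in> C \<Longrightarrow> J \<subseteq> K \<or> K \<subseteq> J"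
      by (auto simp: subset.chain_def)
    have "R.subspace (\<Union>C)"
    proof (rule R.subspaceI)
      show "0 \<in> \<Union>C" using C(1) CA R.subspace_0 by fastforce
      show "x + y \<in> \<Union>C" if xy: "x \<in> \<Union>C" "y \<in> \<Union>C" for x y
      proof -
        obtain J K where "J \<in> C" "K \<in> C" "x \<in> J" "y \<in> K" using xy by auto
        with total[of J K] obtain L where L: "L \<in> C" "x \<in> L" "y \<in> L" by auto
        then have "x + y \<in> L" using CA by (intro R.subspace_add) auto
        then show ?thesis using L(1) by blast
      qed
      show "c * x \<in> \<Union>C" if x: "x \<in> \<Union>C" for c x
      proof -
        obtain J where J: "J \<in> C" "x \<in> J" using x by blast
        then have "c * x \<in> J" using CA by (intro R.subspace_scale) auto
        then show ?thesis using J(1) by blast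
      qed
    qed
    then show "\<Union>C \<in> ?A" using C(1) CA by auto
  qed
  then obtain p where pA: "p \<in> ?A" and p_max: "\<forall>J\<in>?A. p \<subseteq> J \<longrightarrow> J = p" by (rule bexE)
  have p: "R.subspace p" "1 \<notin> p" "I \<subseteq> p" using pA by simp_all
  have max: "J = p" if "R.subspace J" "1 \<notin> J" "p \<subseteq> J" for J
    using p_max that p(3) by simp
  \<comment> \<open>The ideal generated by \<open>p\<close> and \<open>a\<close> is improper by maximality.\<close>
  have comaximal: "\<exists>c. 1 - c * a \<in> p" if "a \<notin> p" for a
  proof -
    let ?J = "{x. \<exists>c. x - c * a \<in> p}"
    have J: "R.subspace ?J"
    proof (rule R.subspaceI)
      show "0 \<in> ?J" using R.subspace_0[OF p(1)] by (intro CollectI exI[of _ 0]) simp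
      show "x + y \<in> ?J" if xy: "x \<in> ?J" "y \<in> ?J" for x y
      proof -
        obtain c d where "x - c * a \<in> p" "y - d * a \<in> p" using xy by auto
        then have "(x - c * a) + (y - d * a) \<in> p" by (rule R.subspace_add[OF p(1)])
        then have "(x + y) - (c + d) * a \<in> p"
          by (rule back_subst[of "\<lambda>z. z \<in> p"]) (simp add: algebra_simps)
        then show ?thesis by blast
      qed
      show "e * x \<in> ?J" if x: "x \<in> ?J" for e x
      proof -
        obtain c where "x - c * a \<in> p" using x by auto
        then have "e * (x - c * a) \<in> p" by (rule R.subspace_scale[OF p(1)])
        then have "e * x - (e * c) * a \<in> p"
          by (rule back_subst[of "\<lambda>z. z \<in> p"]) (simp only: right_diff_distrib mult.assoc)
        then show ?thesis by blast
      qed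
    qed
    have pJ: "p \<subseteq> ?J"
    proof
      show "x \<in> ?J" if "x \<in> p" for x using that by (intro CollectI exI[of _ 0]) simp
    qed
    have aJ: "a \<in> ?J" using R.subspace_0[OF p(1)] by (intro CollectI exI[of _ 1]) simp
    have "1 \<in> ?J"
    proof (rule ccontr)
      assume "1 \<notin> ?J"
      from max[OF J this pJ] aJ that show False by (simp only:)
    qed
    then show ?thesis by (rule CollectD)
  qed
  have "a \<in> p \<or> b \<in> p" if ab: "a * b \<in> p" for a b
  proof (rule disjCI)
    assume "b \<notin> p"
    then obtain c where c: "1 - c * b \<in> p" using comaximal by blast
    have "a * (1 - c * b) + c * (a * b) \<in> p"
      by (rule R.subspace_add[OF p(1) R.subspace_scale[OF p(1) c] R.subspace_scale[OF p(1) ab]])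
    moreover have "a * (1 - c * b) + c * (a * b) = a" by (simp add: right_diff_distrib mult.left_commute)
    ultimately show "a \<in> p" by (simp only:)
  qed
  then have "prime_ideal p" using p unfolding prime_ideal_def by blast
  then show ?thesis using p(3) by blast
qed

lemma not_in_prime_mult: "prime_ideal p \<Longrightarrow> s \<notin> p \<Longrightarrow> t \<notin> p \<Longrightarrow> s * t \<notin> p"
  unfolding prime_ideal_def by blast

lemma one_not_in_prime: "prime_ideal p \<Longrightarrow> 1 \<notin> p"
  unfolding prime_ideal_def by blast

context
  fixes p :: "'a::comm_ring_1 set" and sc :: "'a \<Rightarrow> 'm::ab_group_add \<Rightarrow> 'm"
  assumes prime: "prime_ideal p" and sc: "module sc"
begin

interpretation module sc by (rule sc)

lemma loc_rel_iff: "((m, s), (m', s')) \<in> loc_rel sc p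
    \<longleftrightarrow> s \<notin> p \<and> s' \<notin> p \<and> (\<exists>t. t \<notin> p \<and> sc (t * s') m = sc (t * s) m')"
  by (simp add: loc_rel_def scale_right_diff_distrib)

lemma equiv_loc_rel: "equiv (UNIV \<times> (- p)) (loc_rel sc p)"
proof (rule equivI)
  show "loc_rel sc p \<subseteq> (UNIV \<times> (- p)) \<times> (UNIV \<times> (- p))" by (auto simp: loc_rel_def)
  show "refl_on (UNIV \<times> (- p)) (loc_rel sc p)"
    using one_not_in_prime[OF prime] by (auto simp: refl_on_def loc_rel_iff)
  show "sym (loc_rel sc p)"
  proof (rule symI, clarify)
    fix m s m' s'
    assume "((m, s), m', s') \<in> loc_rel sc p"
    then obtain t where "s \<notin> p" "s' \<notin> p" "t \<notin> p" "sc (t * s) m' = sc (t * s') m"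
      unfolding loc_rel_iff by metis
    then show "((m', s'), m, s) \<in> loc_rel sc p" unfolding loc_rel_iff by blast
  qed
  show "trans (loc_rel sc p)"
  proof (rule transI, clarify)
    fix m s m' s' m'' s''
    assume "((m, s), m', s') \<in> loc_rel sc p" "((m', s'), m'', s'') \<in> loc_rel sc p"
    then obtain t t' where s: "s \<notin> p" "s' \<notin> p" "s'' \<notin> p" "t \<notin> p" "t' \<notin> p"
      and eq: "sc (t * s') m = sc (t * s) m'" "sc (t' * s'') m' = sc (t' * s') m''"
      unfolding loc_rel_iff by blast
    have "sc (t * t' * s' * s'') m = sc (t' * s'') (sc (t * s') m)" by (simp add: mult_ac)
    also have "\<dots> = sc (t * s) (sc (t' * s'') m')" unfolding eq(1) by (simp add: mult_ac)
    also have "\<dots> = sc (t * t' * s' * s) m''" unfolding eq(2) by (simp add: mult_ac)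
    finally show "((m, s), m'', s'') \<in> loc_rel sc p"
      unfolding loc_rel_iff using s
      by (intro conjI exI[of _ "t * t' * s'"]) (simp_all add: not_in_prime_mult[OF prime])
  qed
qed

lemma mem_loc_frac: "(m', s') \<in> loc_frac sc p m s
    \<longleftrightarrow> s \<notin> p \<and> s' \<notin> p \<and> (\<exists>t. t \<notin> p \<and> sc (t * s') m = sc (t * s) m')"
  unfolding loc_frac_def by (simp add: loc_rel_iff)

lemma loc_frac_eqI:
  assumes "s \<notin> p" "s' \<notin> p" "t \<notin> p" "sc (t * s') m = sc (t * s) m'"
  shows "loc_frac sc p m s = loc_frac sc p m' s'"
  unfolding loc_frac_def
  by (rule equiv_class_eq[OF equiv_loc_rel]) (use assms in \<open>auto simp: loc_rel_iff\<close>)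

lemma loc_frac_self: "s \<notin> p \<Longrightarrow> (m, s) \<in> loc_frac sc p m s"
  using one_not_in_prime[OF prime] by (auto simp: mem_loc_frac)

lemma loc_frac_in: "s \<notin> p \<Longrightarrow> loc_frac sc p m s \<in> localization sc p"
  unfolding localization_def loc_frac_def by (rule quotientI) simp

lemma localizationE:
  assumes "X \<in> localization sc p"
  obtains m s where "s \<notin> p" "X = loc_frac sc p m s"
  using assms unfolding localization_def loc_frac_def by (auto elim!: quotientE)

end

lemma loc_scale_frac:
  assumes prime: "prime_ideal p" and sc: "module sc" and s: "s \<notin> p" "s' \<notin> p"
  shows "loc_scale sc p (loc_frac (*) p a s) (loc_frac sc p m s') = loc_frac sc p (sc a m) (s * s')"
proof -
  interpret module sc by (rule sc)
  note nmult = not_in_prime_mult[OF prime]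
  have "loc_frac sc p (sc b n) (u * u') = loc_frac sc p (sc a m) (s * s')"
    if mem: "(b, u) \<in> loc_frac (*) p a s" "(n, u') \<in> loc_frac sc p m s'" for b u n u'
  proof -
    obtain t t' where t: "t \<notin> p" "t' \<notin> p" "u \<notin> p" "u' \<notin> p" and eq: "t * u * a = t * s * b"
      "sc (t' * u') m = sc (t' * s') n"
      using mem unfolding mem_loc_frac[OF prime module_ring] mem_loc_frac[OF prime sc] by blast
    have "sc (t * t' * (s * s')) (sc b n) = sc (t * s * b) (sc (t' * s') n)" by (simp add: mult_ac)
    also have "\<dots> = sc (t * u * a) (sc (t' * u') m)" unfolding eq ..
    also have "\<dots> = sc (t * t' * (u * u')) (sc a m)" by (simp add: mult_ac)
    finally show ?thesis
      by (intro loc_frac_eqI[OF prime sc, of _ _ "t * t'"]) (use s t nmult in auto)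
  qed
  then show ?thesis unfolding loc_scale_def
    using loc_frac_self[OF prime module_ring s(1), of a] loc_frac_self[OF prime sc s(2), of m] by fast
qed

lemma module_alg_scale: "ring_morphism \<iota> \<Longrightarrow> module (alg_scale \<iota>)"
  unfolding ring_morphism_def by unfold_locales (simp_all add: alg_scale_def algebra_simps)

text \<open>
  If \<open>\<iota> r = 0\<close> and \<open>r \<noteq> 0\<close>, localize at a prime ideal that contains the annihilator of \<open>r\<close>. There \<open>r\<close>
  kills the localization of \<open>S\<close>, which is free of positive rank over the local ring, so \<open>r/1 = 0\<close>: some
  element outside the prime ideal annihilates \<open>r\<close>, a contradiction.
\<close>
lemma inj_if_constant_rank:
  fixes \<iota> :: "'r::comm_ring_1 \<Rightarrow> 's::comm_ring_1"
  assumes \<iota>: "ring_morphism \<iota>" and rank: "constant_rank (alg_scale \<iota>) n" and n: "n > 0"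
  shows "inj \<iota>"
proof -
  have add: "\<iota> (x + y) = \<iota> x + \<iota> y" for x y using \<iota> by (simp add: ring_morphism_def)
  have zero: "r = 0" if r: "\<iota> r = 0" for r
  proof (rule ccontr)
    assume "r \<noteq> 0"
    interpret R: module "(*) :: 'r \<Rightarrow> 'r \<Rightarrow> 'r" by (rule module_ring)
    have "R.subspace {x. x * r = 0}"
      by (rule R.subspaceI) (simp_all add: distrib_right mult.assoc)
    moreover have "1 \<notin> {x. x * r = 0}" using \<open>r \<noteq> 0\<close> by simp
    ultimately obtain p where prime: "prime_ideal p" and ann: "{x. x * r = 0} \<subseteq> p"
      using exists_prime_ideal by blast
    note one = one_not_in_prime[OF prime] and S = module_alg_scale[OF \<iota>]
    let ?sc = "alg_scale \<iota>" and ?R = "localization (*) p"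
    let ?F = "{..<n} \<rightarrow>\<^sub>E ?R" and ?r = "loc_frac (*) p r 1"
    obtain \<Phi> where bij: "bij_betw \<Phi> ?F (localization ?sc p)"
      and lin: "\<And>a c. a \<in> ?R \<Longrightarrow> c \<in> ?F \<Longrightarrow>
           \<Phi> (\<lambda>i\<in>{..<n}. loc_scale (*) p a (c i)) = loc_scale ?sc p a (\<Phi> c)"
    proof -
      have "loc_free_of_rank ?sc p n" using rank prime by (simp add: constant_rank_def)
      then show ?thesis unfolding loc_free_of_rank_def Let_def using that by (elim exE conjE) simp
    qed
    have killed: "loc_scale ?sc p ?r X = loc_frac ?sc p 0 1" if X: "X \<in> localization ?sc p" for X
    proof -
      obtain m s where s: "s \<notin> p" and X: "X = loc_frac ?sc p m s"
        using localizationE[OF prime S X] .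
      have "loc_scale ?sc p ?r X = loc_frac ?sc p (?sc r m) (1 * s)"
        unfolding X by (rule loc_scale_frac[OF prime S one s])
      also have "\<dots> = loc_frac ?sc p 0 1"
        by (rule loc_frac_eqI[OF prime S, of _ _ 1]) (use s one r in \<open>simp_all add: alg_scale_def\<close>)
      finally show ?thesis .
    qed
    define c where "c x = (\<lambda>i\<in>{..<n}. loc_frac (*) p x 1)" for x :: 'r
    have cF: "c x \<in> ?F" for x
      unfolding c_def using loc_frac_in[OF prime module_ring one] by auto
    have scale_c: "(\<lambda>i\<in>{..<n}. loc_scale (*) p ?r (c x i)) = c (r * x)" for x
      unfolding c_def
      by (rule restrict_ext) (simp add: loc_scale_frac[OF prime module_ring one one])
    have \<Phi>c: "\<Phi> (c (r * x)) = loc_frac ?sc p 0 1" for x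
    proof -
      have "\<Phi> (c (r * x)) = loc_scale ?sc p ?r (\<Phi> (c x))"
        unfolding scale_c[symmetric] by (rule lin[OF loc_frac_in[OF prime module_ring one] cF])
      also have "\<dots> = loc_frac ?sc p 0 1"
        by (rule killed) (use bij cF in \<open>auto simp: bij_betw_def\<close>)
      finally show ?thesis .
    qed
    have "c (r * 1) = c (r * 0)"
      using bij cF \<Phi>c by (metis bij_betw_def inj_onD)
    then have "c r 0 = c 0 0" by simp
    then have "loc_frac (*) p r 1 = loc_frac (*) p 0 1" using n by (simp add: c_def)
    then have "(0, 1) \<in> loc_frac (*) p r 1" using loc_frac_self[OF prime module_ring one, of 0] by simp
    then obtain t where "t \<notin> p" "t * r = 0"
      unfolding mem_loc_frac[OF prime module_ring] by auto
    then show False using ann by auto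
  qed
  show ?thesis
  proof (rule injI)
    fix x y assume eq: "\<iota> x = \<iota> y"
    have "\<iota> (x - y) + \<iota> y = \<iota> x" using add[of "x - y" y] by simp
    then have "\<iota> (x - y) = 0" unfolding eq by simp
    then show "x = y" using zero[of "x - y"] by simp
  qed
qed


section \<open>Restriction of scalars\<close>

lemma module_restrict_scalars:
  assumes \<iota>: "ring_morphism \<iota>" and sc: "module sc"
  shows "module (vec_scale \<iota> sc)"
proof -
  interpret module sc by (rule sc)
  show ?thesis using \<iota> unfolding ring_morphism_def
    by unfold_locales (simp_all add: vec_scale_def scale_left_distrib scale_right_distrib)
qed

lemma dual_system_restrict_scalars:
  assumes \<iota>: "ring_morphism \<iota>" and e: "dual_system (alg_scale \<iota>) J e \<epsilon>"
    and \<phi>: "dual_system sc I b \<phi>" and sc: "module sc"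
  shows "dual_system (vec_scale \<iota> sc) (I \<times> J) (\<lambda>(i, j). sc (e j) (b i)) (\<lambda>(i, j) x. \<epsilon> j (\<phi> i x))"
  unfolding dual_system_def
proof (intro conjI ballI allI)
  interpret module sc by (rule sc)
  show "finite (I \<times> J)" using e \<phi> by (simp add: dual_system_def)
  fix x
  have "(\<Sum>k\<in>I \<times> J. vec_scale \<iota> sc ((\<lambda>(i, j) x. \<epsilon> j (\<phi> i x)) k x) ((\<lambda>(i, j). sc (e j) (b i)) k))
      = (\<Sum>i\<in>I. \<Sum>j\<in>J. sc (alg_scale \<iota> (\<epsilon> j (\<phi> i x)) (e j)) (b i))"
    by (simp add: sum.cartesian_product vec_scale_def alg_scale_def case_prod_unfold)
  also have "\<dots> = (\<Sum>i\<in>I. sc (\<phi> i x) (b i))"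
    using e by (simp add: dual_system_def flip: scale_sum_left)
  also have "\<dots> = x" using \<phi> by (simp add: dual_system_def)
  finally show "(\<Sum>k\<in>I \<times> J. vec_scale \<iota> sc ((\<lambda>(i, j) x. \<epsilon> j (\<phi> i x)) k x) ((\<lambda>(i, j). sc (e j) (b i)) k)) = x" .
next
  fix k assume k: "k \<in> I \<times> J"
  obtain i j where ij: "k = (i, j)" "i \<in> I" "j \<in> J" using k by (rule SigmaE)
  interpret \<phi>: module_hom sc "(*)" "\<phi> i" using \<phi> ij by (simp add: dual_system_def)
  interpret \<epsilon>: module_hom "alg_scale \<iota>" "(*)" "\<epsilon> j" using e ij by (simp add: dual_system_def)
  have "module_hom (vec_scale \<iota> sc) (*) (\<lambda>x. \<epsilon> j (\<phi> i x))"
  proof (rule linear_formI[OF module_restrict_scalars[OF \<iota> sc]])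
    show "\<epsilon> j (\<phi> i (x + y)) = \<epsilon> j (\<phi> i x) + \<epsilon> j (\<phi> i y)" for x y
      unfolding \<phi>.add \<epsilon>.add ..
    show "\<epsilon> j (\<phi> i (vec_scale \<iota> sc c x)) = c * \<epsilon> j (\<phi> i x)" for c x
      unfolding vec_scale_def \<phi>.scale using \<epsilon>.scale[of c "\<phi> i x"] by (simp only: alg_scale_def)
  qed
  then show "module_hom (vec_scale \<iota> sc) (*) ((\<lambda>(i, j) x. \<epsilon> j (\<phi> i x)) k)"
    by (simp add: ij(1))
qed

lemma alg_trace_eq:
  assumes \<iota>: "ring_morphism \<iota>" and e: "dual_basis (alg_scale \<iota>) n e \<epsilon>"
  shows "alg_trace \<iota> x = (\<Sum>j<n. \<epsilon> j (x * e j))"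
  unfolding alg_trace_def
proof (rule module_trace_eq[OF e])
  show "module_hom (alg_scale \<iota>) (alg_scale \<iota>) ((*) x)"
    using module_alg_scale[OF \<iota>]
    by (simp add: module_hom_iff) (simp add: alg_scale_def distrib_left mult.left_commute)
qed

lemma alg_trace_additive:
  assumes \<iota>: "ring_morphism \<iota>" and proj: "fg_projective (alg_scale \<iota>)"
  shows "alg_trace \<iota> (x + y) = alg_trace \<iota> x + alg_trace \<iota> y"
proof -
  obtain n e \<epsilon> where e: "dual_basis (alg_scale \<iota>) n e \<epsilon>" using proj by (auto simp: fg_projective_def)
  have "\<epsilon> j ((x + y) * e j) = \<epsilon> j (x * e j) + \<epsilon> j (y * e j)" if "j < n" for j
  proof -
    interpret \<epsilon>: module_hom "alg_scale \<iota>" "(*)" "\<epsilon> j"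
      using e that by (simp add: dual_basis_def linear_forms_def)
    show ?thesis unfolding distrib_right \<epsilon>.add ..
  qed
  then show ?thesis by (simp add: alg_trace_eq[OF \<iota> e] sum.distrib)
qed

text \<open>
  Transitivity of the trace: the trace over the base ring of a linear endomorphism is the trace of
  its trace.
\<close>
lemma trace_restrict_scalars:
  assumes \<iota>: "ring_morphism \<iota>" and e: "dual_basis (alg_scale \<iota>) n e \<epsilon>"
    and \<phi>: "dual_system sc I b \<phi>" and g: "module_hom sc sc g"
  shows "(\<Sum>(i, j)\<in>I \<times> {..<n}. \<epsilon> j (\<phi> i (g (sc (e j) (b i))))) = alg_trace \<iota> (\<Sum>i\<in>I. \<phi> i (g (b i)))"
proof -
  interpret g: module_hom sc sc g by (rule g)
  have "\<phi> i (g (sc (e j) (b i))) = \<phi> i (g (b i)) * e j" if "i \<in> I" for i j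
  proof -
    interpret \<phi>: module_hom sc "(*)" "\<phi> i" using \<phi> that by (simp add: dual_system_def)
    show ?thesis unfolding g.scale \<phi>.scale by (rule mult.commute)
  qed
  then have "(\<Sum>(i, j)\<in>I \<times> {..<n}. \<epsilon> j (\<phi> i (g (sc (e j) (b i)))))
      = (\<Sum>i\<in>I. \<Sum>j<n. \<epsilon> j (\<phi> i (g (b i)) * e j))"
    by (simp add: sum.cartesian_product[symmetric])
  also have "\<dots> = (\<Sum>j<n. \<Sum>i\<in>I. \<epsilon> j (\<phi> i (g (b i)) * e j))" by (rule sum.swap)
  also have "\<dots> = (\<Sum>j<n. \<epsilon> j ((\<Sum>i\<in>I. \<phi> i (g (b i))) * e j))"
  proof (rule sum.cong[OF refl])
    fix j assume j: "j \<in> {..<n}"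
    interpret \<epsilon>: module_hom "alg_scale \<iota>" "(*)" "\<epsilon> j"
      using e j by (simp add: dual_basis_def linear_forms_def)
    show "(\<Sum>i\<in>I. \<epsilon> j (\<phi> i (g (b i)) * e j)) = \<epsilon> j ((\<Sum>i\<in>I. \<phi> i (g (b i))) * e j)"
      unfolding sum_distrib_right \<epsilon>.sum ..
  qed
  also have "\<dots> = alg_trace \<iota> (\<Sum>i\<in>I. \<phi> i (g (b i)))" by (rule alg_trace_eq[OF \<iota> e, symmetric])
  finally show ?thesis .
qed

section \<open>Automorphisms of the vector algebra and the colour algebra\<close>

text \<open>
  The data of a colour algebra, with the constant \<open>\<kappa>\<close> in place of \<open>1/2\<close>.
\<close>
locale colour_space = hermitian_volume sc vol cj h
  for sc :: "'s::comm_ring_1 \<Rightarrow> 'p::ab_group_add \<Rightarrow> 'p" and vol cj h +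
  fixes \<iota> :: "'r::comm_ring_1 \<Rightarrow> 's" and \<kappa> :: 'r
  assumes two_unit_base: "(2 :: 'r) dvd 1"
    and \<iota>_morphism: "ring_morphism \<iota>" and \<iota>_inj: "inj \<iota>"
    and base_projective: "fg_projective (alg_scale \<iota>)" and projective: "fg_projective sc"
    and cj_trace: "\<iota> (alg_trace \<iota> x) = x + cj x"
begin

abbreviation "tr \<equiv> alg_trace \<iota>"
abbreviation "scR \<equiv> vec_scale \<iota> sc"

definition mul :: "'r \<times> 'p \<Rightarrow> 'r \<times> 'p \<Rightarrow> 'r \<times> 'p" where
  "mul x y = (fst x * fst y - \<kappa> * tr (h (snd x) (snd y)),
     scR (fst x) (snd y) + scR (fst y) (snd x) + cross (snd x) (snd y))"

lemma \<iota>_simps: "\<iota> 1 = 1" "\<iota> 0 = 0" "\<iota> (a + b) = \<iota> a + \<iota> b" "\<iota> (a * b) = \<iota> a * \<iota> b"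
proof -
  show "\<iota> 1 = 1" "\<iota> (a * b) = \<iota> a * \<iota> b" and add: "\<iota> (a + b) = \<iota> a + \<iota> b" for a b
    using \<iota>_morphism by (simp_all add: ring_morphism_def)
  show "\<iota> 0 = 0" using add[of 0 0] by simp
qed

lemma scR_simps: "scR 1 u = u" "scR 0 u = 0" "scR a 0 = 0" "scR a (u + v) = scR a u + scR a v"
    "scR (a + b) u = scR a u + scR b u" "scR a (scR b u) = scR (a * b) u"
  by (simp_all add: vec_scale_def \<iota>_simps scale_right_distrib scale_left_distrib)

lemma ex_dual_system: "\<exists>(m::nat) b \<phi>. dual_system sc {..<m} b \<phi>"
  using projective by (simp add: fg_projective_def dual_basis_iff)

lemma tr_zero: "tr 0 = 0"
  using alg_trace_additive[OF \<iota>_morphism base_projective, of 0 0] by simp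

lemma tr_h_sym: "tr (h v u) = tr (h u v)"
  by (rule injD[OF \<iota>_inj]) (simp add: cj_trace cj_h add.commute)

lemma module_scR: "module scR"
  by (rule module_restrict_scalars[OF \<iota>_morphism module_axioms])

lemma module_col: "module (col_scale \<iota> sc)"
  by unfold_locales (simp_all add: col_scale_def scR_simps distrib_left distrib_right mult.assoc)

text \<open>
  The automorphism \<open>f\<close> conjugates the operator \<open>x \<mapsto> (x \<times> u) \<times> v\<close> into \<open>x \<mapsto> (x \<times> f u) \<times> f v\<close>. Both are
  linear over \<open>S\<close>, but \<open>f\<close> is linear over \<open>R\<close> only, so it is their traces over \<open>R\<close> that agree; these are
  the traces of \<open>-2 h(u, v)\<close> and \<open>-2 h(f u, f v)\<close>.
\<close>
theorem vector_automorphism_preserves_trace: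
  assumes f: "f \<in> alg_aut scR cross"
  shows "tr (h (f u) (f v)) = tr (h u v)"
proof -
  have f_lin: "module_hom scR scR f" and f_bij: "bij f" and f_cross: "f (cross x y) = cross (f x) (f y)" for x y
    using f unfolding alg_aut_def by blast+
  obtain n e \<epsilon> where e: "dual_basis (alg_scale \<iota>) n e \<epsilon>"
    using base_projective by (auto simp: fg_projective_def)
  obtain m :: nat and b \<phi> where \<phi>: "dual_system sc {..<m} b \<phi>"
    using ex_dual_system by blast
  note dual = dual_system_restrict_scalars[OF \<iota>_morphism e[unfolded dual_basis_iff] \<phi> module_axioms]
  let ?g = "\<lambda>u v x. cross (cross x u) v"
  have g_lin: "module_hom sc sc (?g u v)" for u v
    using module_axioms by (simp add: module_hom_iff cross_simps)
  have g_linR: "module_hom scR scR (?g u v)" for u v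
    using module_scR by (simp add: module_hom_iff cross_simps) (simp add: vec_scale_def cross_simps)
  have trace: "(\<Sum>k\<in>{..<m} \<times> {..<n}. (\<lambda>(i, j) x. \<epsilon> j (\<phi> i x)) k (?g u v ((\<lambda>(i, j). sc (e j) (b i)) k)))
      = tr (- (2 * h u v))" for u v
    using trace_restrict_scalars[OF \<iota>_morphism e \<phi> g_lin, of u v]
    unfolding trace_cross_cross[OF \<phi>] by (simp add: case_prod_unfold)
  have "tr (- (2 * h (f u) (f v))) = tr (- (2 * h u v))"
    unfolding trace[symmetric]
    by (rule trace_conjugate[OF dual f_lin f_bij g_linR g_linR]) (simp add: f_cross)
  moreover have tr_neg: "tr (- (2 * x)) = - (2 * tr x)" for x
  proof -
    have "tr (- (2 * x)) + (tr x + tr x) = tr (- (2 * x) + (x + x))"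
      by (simp only: alg_trace_additive[OF \<iota>_morphism base_projective])
    also have "\<dots> = 0" by (simp add: tr_zero)
    finally show ?thesis unfolding mult_2[of "tr x"] eq_neg_iff_add_eq_0 .
  qed
  ultimately have "2 * (tr (h (f u) (f v)) - tr (h u v)) = 0" by (simp add: right_diff_distrib)
  then have "tr (h (f u) (f v)) - tr (h u v) = 0" by (rule two_cancel[OF two_unit_base])
  then show ?thesis by simp
qed

lemma extend_automorphism:
  assumes f: "f \<in> alg_aut scR cross"
  shows "extend_Col f \<in> alg_aut (col_scale \<iota> sc) mul"
proof -
  have f_lin: "module_hom scR scR f" and f_bij: "bij f" and f_cross: "f (cross x y) = cross (f x) (f y)" for x y
    using f unfolding alg_aut_def by blast+
  interpret f: module_hom scR scR f by (rule f_lin)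
  have "module_hom (col_scale \<iota> sc) (col_scale \<iota> sc) (extend_Col f)"
    using module_col by (simp add: module_hom_iff) (auto simp: extend_Col_def col_scale_def f.add f.scale)
  moreover have "bij (extend_Col f)"
  proof (rule bijI)
    show "inj (extend_Col f)" using f_bij by (auto simp: extend_Col_def inj_def bij_def)
    show "surj (extend_Col f)"
    proof (rule surjI[of _ "\<lambda>(a, u). (a, inv f u)"])
      show "extend_Col f ((\<lambda>(a, u). (a, inv f u)) x) = x" for x
        using f_bij by (cases x) (simp add: extend_Col_def bij_is_surj surj_f_inv_f)
    qed
  qed
  moreover have "extend_Col f (mul x y) = mul (extend_Col f x) (extend_Col f y)" for x y
    by (simp add: extend_Col_def mul_def case_prod_unfold vector_automorphism_preserves_trace[OF f]
        f.add f.scale f_cross)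
  ultimately show ?thesis by (simp add: alg_aut_def)
qed

text \<open>
  An automorphism fixes the unit element and maps commutators to commutators. The commutator of \<open>u\<close>
  and \<open>v\<close> in \<open>P\<close> is \<open>2 (u \<times> v)\<close>, and all commutators lie in \<open>P\<close>. As the cross products generate \<open>P\<close>
  additively and two is invertible, \<open>P\<close> is mapped to itself.
\<close>
lemma restrict_automorphism:
  assumes G: "G \<in> alg_aut (col_scale \<iota> sc) mul"
  shows "preserves_P G" "restrict_P G \<in> alg_aut scR cross" "extend_Col (restrict_P G) = G"
proof -
  have G_lin: "module_hom (col_scale \<iota> sc) (col_scale \<iota> sc) G" and G_bij: "bij G"
    and G_mul: "G (mul x y) = mul (G x) (G y)" for x y
    using G unfolding alg_aut_def by blast+
  interpret G: module_hom "col_scale \<iota> sc" "col_scale \<iota> sc" G by (rule G_lin)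
  obtain m :: nat and b \<phi> where \<phi>: "dual_system sc {..<m} b \<phi>"
    using ex_dual_system by blast
  have zero: "cross u 0 = 0" "cross 0 u = 0" for u
    using cross_simps(1)[of 0 0 u] cross_simps(2)[of u 0 0] by simp_all
  have unit: "mul (1, 0) x = x" "mul x (1, 0) = x" for x
    by (simp_all add: mul_def scR_simps h_zero zero tr_zero)
  have G_unit: "G (1, 0) = (1, 0)"
  proof -
    obtain x where x: "G x = (1, 0)" using G_bij by (metis bij_pointE)
    have "G (1, 0) = mul (G (1, 0)) (G x)" unfolding x unit ..
    also have "\<dots> = (1, 0)" unfolding G_mul[symmetric] unit by (rule x)
    finally show ?thesis .
  qed
  have commutator: "fst (mul x y - mul y x) = 0" for x y
    by (simp add: mul_def mult.commute tr_h_sym[of "snd y" "snd x"])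
  \<comment> \<open>The component in \<open>R\<close> of the image of \<open>P\<close> is additive and vanishes on cross products.\<close>
  have "fst (G (0, u)) = 0" for u
  proof (rule additive_eq_0_if_cross[OF \<phi>, of "\<lambda>u. fst (G (0, u))"])
    show add: "fst (G (0, u + v)) = fst (G (0, u)) + fst (G (0, v))" for u v
      using G.add[of "(0, u)" "(0, v)"] by simp
    show "fst (G (0, cross u v)) = 0" for u v
    proof (rule two_cancel[OF two_unit_base])
      have "mul (0, u) (0, v) - mul (0, v) (0, u) = (0, cross u v + cross u v)"
        by (simp add: mul_def scR_simps tr_h_sym[of v u] cross_swap[of v u])
      then have "fst (G (0, cross u v + cross u v)) = fst (G (mul (0, u) (0, v) - mul (0, v) (0, u)))"
        by (rule arg_cong[OF sym])
      also have "\<dots> = 0" unfolding G.diff G_mul by (rule commutator)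
      finally have "fst (G (0, cross u v + cross u v)) = 0" .
      then show "2 * fst (G (0, cross u v)) = 0" unfolding add mult_2 .
    qed
  qed
  then have G_P: "G (0, u) = (0, restrict_P G u)" for u
    by (simp add: restrict_P_def prod_eq_iff)
  show "preserves_P G" by (simp add: preserves_P_def G_P)
  have G_pair: "G (a, u) = (a, restrict_P G u)" for a u
  proof -
    have "G (a, u) = G (col_scale \<iota> sc a (1, 0) + (0, u))" by (simp add: col_scale_def scR_simps)
    also have "\<dots> = (a, restrict_P G u)"
      unfolding G.add G.scale G_unit G_P by (simp add: col_scale_def scR_simps)
    finally show ?thesis .
  qed
  then show "extend_Col (restrict_P G) = G" by (auto simp: extend_Col_def)
  have "module_hom scR scR (restrict_P G)"
  proof -
    have "restrict_P G (u + v) = restrict_P G u + restrict_P G v" for u v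
      using G.add[of "(0, u)" "(0, v)"] by (simp add: G_P)
    moreover have "restrict_P G (scR c u) = scR c (restrict_P G u)" for c u
      using G.scale[of c "(0, u)"] by (simp add: G_P col_scale_def)
    ultimately show ?thesis using module_scR by (simp add: module_hom_iff)
  qed
  moreover have "bij (restrict_P G)"
  proof (rule bijI)
    show "inj (restrict_P G)"
    proof (rule injI)
      fix u v assume "restrict_P G u = restrict_P G v"
      then have "G (0, u) = G (0, v)" by (simp add: G_P)
      then show "u = v" using injD[OF bij_is_inj[OF G_bij]] by blast
    qed
    show "surj (restrict_P G)"
    proof (rule surjI[of _ "\<lambda>v. snd (inv G (0, v))"])
      fix v
      have "G (inv G (0, v)) = (0, v)" using G_bij by (simp add: bij_is_surj surj_f_inv_f)
      then show "restrict_P G (snd (inv G (0, v))) = v"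
        using G_pair[of "fst (inv G (0, v))" "snd (inv G (0, v))"] by simp
    qed
  qed
  moreover have "restrict_P G (cross u v) = cross (restrict_P G u) (restrict_P G v)" for u v
    using arg_cong[OF G_mul[of "(0, u)" "(0, v)"], of snd] by (simp add: mul_def G_pair scR_simps)
  ultimately show "restrict_P G \<in> alg_aut scR cross" by (simp add: alg_aut_def)
qed

end

theorem proposition3p6:
  fixes \<iota> :: "'r::comm_ring_1 \<Rightarrow> 's::comm_ring_1"
    and cj :: "'s \<Rightarrow> 's"
    and sc :: "'s \<Rightarrow> 'p::ab_group_add \<Rightarrow> 'p"
    and h :: "'p \<Rightarrow> 'p \<Rightarrow> 's"
    and \<alpha> :: "(('p ^ 3) \<Rightarrow>\<^sub>0 's) set \<Rightarrow> 's"
  assumes "(2 :: 'r) dvd 1"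
    and "quadratic_etale \<iota>"
    and "canonical_involution \<iota> cj"
    and "hermitian_space_rank3 cj sc h"
    and "det_trivialization cj sc h \<alpha>"
  shows "Aut_S_Col \<iota> cj sc h \<alpha> = extend_Col ` (Aut_W \<iota> sc h \<alpha> \<inter> End_S sc) \<and>
         Aut_R_Col \<iota> cj sc h \<alpha> = extend_Col ` Aut_W \<iota> sc h \<alpha> \<and>
         (\<forall>G \<in> Aut_R_Col \<iota> cj sc h \<alpha>.
            preserves_P G \<and> restrict_P G \<in> Aut_W \<iota> sc h \<alpha> \<and> extend_Col (restrict_P G) = G) \<and>
         (\<forall>f \<in> Aut_W \<iota> sc h \<alpha>. restrict_P (extend_Col f :: 'r \<times> 'p \<Rightarrow> 'r \<times> 'p) = f) \<and>
         (\<forall>f \<in> Aut_W \<iota> sc h \<alpha>. \<forall>g \<in> Aut_W \<iota> sc h \<alpha>.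
            (extend_Col (f \<circ> g) :: 'r \<times> 'p \<Rightarrow> 'r \<times> 'p) = extend_Col f \<circ> extend_Col g)"
proof -
  have \<iota>: "ring_morphism \<iota>" and base: "fg_projective (alg_scale \<iota>)" and rank: "constant_rank (alg_scale \<iota>) 2"
    using assms(2) by (simp_all add: quadratic_etale_def)
  have cj: "ring_morphism cj" "cj (cj x) = x" and cj_tr: "cj x = \<iota> (alg_trace \<iota> x) - x" for x
    using assms(3) unfolding canonical_involution_def by blast+
  have proj: "fg_projective sc" and herm: "nondegenerate_hermitian cj sc h"
    using assms(4) by (simp_all add: hermitian_space_rank3_def)
  have sc: "module sc" using proj by (simp add: fg_projective_def)
  interpret hermitian_form sc cj h
    by (intro hermitian_form.intro hermitian_form_axioms.intro sc cj herm)
  have two: "(2 :: 's) dvd 1"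
  proof -
    obtain c :: 'r where c: "1 = 2 * c" using assms(1) by (rule dvdE)
    have "1 = \<iota> ((1 + 1) * c)" using \<iota> c by (simp add: ring_morphism_def)
    also have "\<dots> = (\<iota> 1 + \<iota> 1) * \<iota> c" using \<iota> unfolding ring_morphism_def by metis
    also have "\<dots> = 2 * \<iota> c" using \<iota> by (simp add: ring_morphism_def)
    finally show ?thesis by (rule dvdI)
  qed
  let ?\<kappa> = "THE c :: 'r. 2 * c = 1"
  interpret hermitian_volume sc "\<lambda>u v w. \<alpha> (wedge3 sc u v w)" cj h
    by (rule hermitian_volume_of_trivialization[OF two assms(5)])
  have inj: "inj \<iota>" by (rule inj_if_constant_rank[OF \<iota> rank]) simp
  interpret colour_space sc "\<lambda>u v w. \<alpha> (wedge3 sc u v w)" cj h \<iota> ?\<kappa>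
    by unfold_locales (simp_all add: assms(1) \<iota> inj base proj cj_tr)
  have cross: "cross_product sc h \<alpha> = cross"
    by (simp add: fun_eq_iff cross_product_def cross_def)
  have trace: "(THE t. \<iota> t = h u v + cj (h u v)) = tr (h u v)" for u v
    using cj_trace[of "h u v"] by (intro the_equality) (auto intro: injD[OF inj])
  have mul: "col_mult \<iota> cj sc h \<alpha> = mul"
    by (simp add: fun_eq_iff col_mult_def mul_def cross trace)
  have W: "Aut_W \<iota> sc h \<alpha> = alg_aut scR cross" by (simp add: Aut_W_def cross)
  have Col: "Aut_R_Col \<iota> cj sc h \<alpha> = alg_aut (col_scale \<iota> sc) mul" by (simp add: Aut_R_Col_def mul)
  have restrict_extend: "restrict_P (extend_Col f :: 'r \<times> 'p \<Rightarrow> 'r \<times> 'p) = f" for f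
    by (simp add: fun_eq_iff restrict_P_def extend_Col_def)
  have preserves: "preserves_P (extend_Col f :: 'r \<times> 'p \<Rightarrow> 'r \<times> 'p)" for f :: "'p \<Rightarrow> 'p"
    by (simp add: preserves_P_def extend_Col_def)
  have "alg_aut (col_scale \<iota> sc) mul = extend_Col ` alg_aut scR cross"
  proof (intro equalityI subsetI)
    show "G \<in> extend_Col ` alg_aut scR cross" if "G \<in> alg_aut (col_scale \<iota> sc) mul" for G
      using restrict_automorphism(2,3)[OF that] by (intro image_eqI[of _ _ "restrict_P G"]) simp_all
  qed (use extend_automorphism in blast)
  moreover have "Aut_S_Col \<iota> cj sc h \<alpha> = extend_Col ` (alg_aut scR cross \<inter> End_S sc)"
  proof (intro equalityI subsetI)
    show "G \<in> extend_Col ` (alg_aut scR cross \<inter> End_S sc)" if "G \<in> Aut_S_Col \<iota> cj sc h \<alpha>" for G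
    proof -
      have G: "G \<in> alg_aut (col_scale \<iota> sc) mul" "restrict_P G \<in> End_S sc"
        using that by (simp_all add: Aut_S_Col_def Col)
      then show ?thesis
        using restrict_automorphism(2,3)[OF G(1)] by (intro image_eqI[of _ _ "restrict_P G"]) simp_all
    qed
    show "G \<in> Aut_S_Col \<iota> cj sc h \<alpha>" if "G \<in> extend_Col ` (alg_aut scR cross \<inter> End_S sc)" for G
      using that extend_automorphism by (auto simp: Aut_S_Col_def Col restrict_extend preserves)
  qed
  moreover have "(extend_Col (f \<circ> g) :: 'r \<times> 'p \<Rightarrow> 'r \<times> 'p) = extend_Col f \<circ> extend_Col g" for f g :: "'p \<Rightarrow> 'p"
    by (simp add: fun_eq_iff extend_Col_def)
  ultimately show ?thesis
    unfolding W Col using restrict_automorphism restrict_extend by simp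
qed

end
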